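(* For every $\mathbf{r}=\mathbf{p}^{-\sigma}$ with $\sigma\in[0,\infty]$ and every $\boldsymbol{\lambda}\in\mathbb{T}^\omega$, the measure $P_{\mathbf{r},\boldsymbol{\lambda}}$ induces a complex homomorphism on $A_\tau(\mathbb{T}^\omega)$, i.e. $f\mapsto\int_{\mathbb{T}^\omega}f\,dP_{\mathbf{r},\boldsymbol{\lambda}}$ is a nonzero multiplicative linear functional on $A_\tau(\mathbb{T}^\omega)$.
   Context: $p_k$ is the $k$-th prime. $\mathbb{Z}^\infty$ is the group of finitely supported integer sequences $\mathbf{n}=(n_1,n_2,\dots)$, $\tau(\mathbf{n})=\sum_k n_k\log p_k$. It is the dual of the compact group $\mathbb{T}^\omega$ (product of countably many circles), via the characters $\gamma_{\mathbf{n}}(\boldsymbol{\lambda})=\prod_k\lambda_k^{n_k}$; Fourier transforms are taken with respect to normalized Haar measure. $A_\tau(\mathbb{T}^\omega)$ is the algebra of all $f\in C(\mathbb{T}^\omega)$ with $\hat f(\mathbf{n})=0$ whenever $\tau(\mathbf{n})<0$, with the uniform norm. For $\sigma\in[0,\infty)$, $\mathbf{p}^{-\sigma}=(p_k^{-\sigma})_{k\ge1}$, and $\mathbf{p}^{-\infty}=\mathbf{0}$. For $\mathbf{r}=\mathbf{p}^{-\sigma}$, the Poisson measure $P_{\mathbf{r}}$ is the unique positive Borel measure on $\mathbb{T}^\omega$ with $\hat P_{\mathbf{r}}(\mathbf{n})=e^{-\sigma|\tau(\mathbf{n})|}$ for all $\mathbf{n}\in\mathbb{Z}^\infty$ (for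 $\sigma=\infty$ this means $1$ if $\mathbf{n}=\mathbf{0}$ and $0$ otherwise). $P_{\mathbf{r},\boldsymbol{\lambda}}(E)=P_{\mathbf{r}}(E\boldsymbol{\lambda}^{-1})$ for Borel $E\subset\mathbb{T}^\omega$. *)

theory Defs
  imports "HOL-Probability.Probability" "HOL-Library.Poly_Mapping"
begin

(* Coordinates are indexed from 0: nth_prime 0 = 2, and coordinate k here is
   coordinate k + 1 in the usual numbering p_1 = 2, p_2 = 3, ... *)
definition nth_prime :: "nat \<Rightarrow> nat" where
  "nth_prime k = enumerate {p. prime p} k"

definition torus :: "(nat \<Rightarrow> complex) set" where
  "torus = {x. \<forall>k. norm (x k) = 1}"

definition torus_mult :: "(nat \<Rightarrow> complex) \<Rightarrow> (nat \<Rightarrow> complex) \<Rightarrow> nat \<Rightarrow> complex" where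
  "torus_mult x y = (\<lambda>k. x k * y k)"

definition torus_inverse :: "(nat \<Rightarrow> complex) \<Rightarrow> nat \<Rightarrow> complex" where
  "torus_inverse x = (\<lambda>k. inverse (x k))"

(* The type nat => complex carries the product topology, so this is the Borel
   sigma-algebra of the subspace torus, with space torus. *)
definition torus_borel :: "(nat \<Rightarrow> complex) measure" where
  "torus_borel = restrict_space borel torus"

definition tau :: "(nat \<Rightarrow>\<^sub>0 int) \<Rightarrow> real" where
  "tau n = (\<Sum>k\<in>Poly_Mapping.keys n. real_of_int (Poly_Mapping.lookup n k) * ln (real (nth_prime k)))"

definition character :: "(nat \<Rightarrow>\<^sub>0 int) \<Rightarrow> (nat \<Rightarrow> complex) \<Rightarrow> complex" where
  "character n x = (\<Prod>k\<in>Poly_Mapping.keys n. x k powi Poly_Mapping.lookup n k)"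

(* The push-forward of M under x |-> x * l, that is, E |-> M (E * l^{-1});
   see emeasure_translate below. *)
definition translate :: "(nat \<Rightarrow> complex) \<Rightarrow> (nat \<Rightarrow> complex) measure \<Rightarrow> (nat \<Rightarrow> complex) measure" where
  "translate l M = distr M torus_borel (\<lambda>x. torus_mult x l)"

definition is_haar :: "(nat \<Rightarrow> complex) measure \<Rightarrow> bool" where
  "is_haar M \<longleftrightarrow> sets M = sets torus_borel \<and> prob_space M \<and> (\<forall>l\<in>torus. translate l M = M)"

definition haar :: "(nat \<Rightarrow> complex) measure" where
  "haar = (THE M. is_haar M)"

definition fourier :: "((nat \<Rightarrow> complex) \<Rightarrow> complex) \<Rightarrow> (nat \<Rightarrow>\<^sub>0 int) \<Rightarrow> complex" where
  "fourier f n = (LINT x|haar. f x * cnj (character n x))"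

definition fourier_measure :: "(nat \<Rightarrow> complex) measure \<Rightarrow> (nat \<Rightarrow>\<^sub>0 int) \<Rightarrow> complex" where
  "fourier_measure M n = (LINT x|M. cnj (character n x))"

(* Functions on the torus are represented by total functions of which only the
   values on torus matter. *)
definition A_tau :: "((nat \<Rightarrow> complex) \<Rightarrow> complex) set" where
  "A_tau = {f. continuous_on torus f \<and> (\<forall>n. tau n < 0 \<longrightarrow> fourier f n = 0)}"

definition prime_powers :: "ennreal \<Rightarrow> nat \<Rightarrow> real" where
  "prime_powers s = (\<lambda>k. if s = \<infinity> then 0 else real (nth_prime k) powr (- enn2real s))"

definition poisson_coeff :: "ennreal \<Rightarrow> (nat \<Rightarrow>\<^sub>0 int) \<Rightarrow> real" where
  "poisson_coeff s n =
    (if s = \<infinity> then (if n = 0 then 1 else 0) else exp (- enn2real s * \<bar>tau n\<bar>))"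

definition is_poisson :: "ennreal \<Rightarrow> (nat \<Rightarrow> complex) measure \<Rightarrow> bool" where
  "is_poisson s M \<longleftrightarrow> sets M = sets torus_borel \<and> finite_measure M \<and>
    (\<forall>n. fourier_measure M n = of_real (poisson_coeff s n))"

(* The exponent s is determined by r, since s |-> prime_powers s is injective. *)
definition poisson :: "(nat \<Rightarrow> real) \<Rightarrow> (nat \<Rightarrow> complex) measure" where
  "poisson r = (THE M. \<exists>s. r = prime_powers s \<and> is_poisson s M)"

definition poisson_at :: "(nat \<Rightarrow> real) \<Rightarrow> (nat \<Rightarrow> complex) \<Rightarrow> (nat \<Rightarrow> complex) measure" where
  "poisson_at r l = translate l (poisson r)"

(* A is an algebra, under pointwise operations, of functions on X represented by
   total functions; the first clause says that phi is well defined on functions on X. *)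
definition complex_homomorphism ::
    "'a set \<Rightarrow> ('a \<Rightarrow> complex) set \<Rightarrow> (('a \<Rightarrow> complex) \<Rightarrow> complex) \<Rightarrow> bool" where
  "complex_homomorphism X A \<phi> \<longleftrightarrow>
    (\<forall>f\<in>A. \<forall>g\<in>A. (\<forall>x\<in>X. f x = g x) \<longrightarrow> \<phi> f = \<phi> g) \<and>
    (\<forall>f\<in>A. \<forall>g\<in>A. \<phi> (\<lambda>x. f x + g x) = \<phi> f + \<phi> g) \<and>
    (\<forall>c. \<forall>f\<in>A. \<phi> (\<lambda>x. c * f x) = c * \<phi> f) \<and>
    (\<forall>f\<in>A. \<forall>g\<in>A. \<phi> (\<lambda>x. f x * g x) = \<phi> f * \<phi> g) \<and>
    (\<exists>f\<in>A. \<phi> f \<noteq> 0)"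

lemma torus_mult_in_torus: "x \<in> torus \<Longrightarrow> l \<in> torus \<Longrightarrow> torus_mult x l \<in> torus"
  by (simp add: torus_def torus_mult_def norm_mult)

lemma measurable_torus_mult:
  assumes "l \<in> torus"
  shows "(\<lambda>x. torus_mult x l) \<in> measurable torus_borel torus_borel"
proof -
  have "continuous_on UNIV (\<lambda>x. torus_mult x l)"
    unfolding torus_mult_def
    by (intro continuous_on_coordinatewise_then_product continuous_intros) auto
  then have "(\<lambda>x. torus_mult x l) \<in> measurable borel borel"
    by (rule borel_measurable_continuous_onI)
  then show ?thesis
    unfolding torus_borel_def using assms
    by (intro measurable_restrict_space3) (auto intro: torus_mult_in_torus)
qed

lemma emeasure_translate:
  assumes M: "sets M = sets torus_borel" and l: "l \<in> torus" and E: "E \<in> sets torus_borel"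
  shows "emeasure (translate l M) E = emeasure M ((\<lambda>x. torus_mult x (torus_inverse l)) ` E)"
proof -
  have sp: "space M = torus" and ET: "E \<subseteq> torus"
    using sets_eq_imp_space_eq[OF M] sets.sets_into_space[OF E]
    by (auto simp: torus_borel_def space_restrict_space)
  have inv: "torus_inverse l \<in> torus"
    using l by (simp add: torus_def torus_inverse_def norm_inverse)
  have nz: "l k \<noteq> 0" for k
    using l by (metis (mono_tags) mem_Collect_eq norm_zero torus_def zero_neq_one)
  have c1: "torus_mult (torus_mult x l) (torus_inverse l) = x" for x
    using nz by (simp add: torus_mult_def torus_inverse_def fun_eq_iff)
  have c2: "torus_mult (torus_mult x (torus_inverse l)) l = x" for x
    using nz by (simp add: torus_mult_def torus_inverse_def fun_eq_iff)
  have "(\<lambda>x. torus_mult x l) -` E \<inter> space M = (\<lambda>x. torus_mult x (torus_inverse l)) ` E"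
  proof (intro equalityI subsetI)
    fix x assume "x \<in> (\<lambda>x. torus_mult x l) -` E \<inter> space M"
    then show "x \<in> (\<lambda>x. torus_mult x (torus_inverse l)) ` E"
      by (intro image_eqI[where x = "torus_mult x l"]) (auto simp: c1)
  next
    fix x assume "x \<in> (\<lambda>x. torus_mult x (torus_inverse l)) ` E"
    then show "x \<in> (\<lambda>x. torus_mult x l) -` E \<inter> space M"
      using ET inv by (auto simp: c2 sp intro: torus_mult_in_torus)
  qed
  moreover have "(\<lambda>x. torus_mult x l) \<in> measurable M torus_borel"
    using measurable_torus_mult[OF l] by (simp add: measurable_cong_sets[OF M refl])
  ultimately show ?thesis
    unfolding translate_def using E by (simp add: emeasure_distr)
qed

end

theory Submission
  imports Defs
begin

text \<open>
  Write \<open>\<gamma>\<^sub>n\<close> for the character with exponent vector \<open>n\<close>. The integral of \<open>\<gamma>\<^sub>n\<close> against the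
  translated Poisson measure is \<open>\<gamma>\<^sub>n(l)\<close> times the Poisson coefficient \<open>exp (- \<sigma> \<bar>tau n\<bar>)\<close>. On the
  half space \<open>tau n \<ge> 0\<close> the absolute value can be dropped, so there the coefficient is
  multiplicative in \<open>n\<close> because \<open>tau\<close> is additive; for \<open>\<sigma> = \<infinity>\<close> the same holds because, by unique
  factorization, \<open>tau\<close> vanishes only at \<open>0\<close> (lemma \<open>poisson_coeff_add\<close>). Hence integration is
  multiplicative on trigonometric polynomials with frequencies in the half space. These are
  uniformly dense in \<open>A_tau\<close> (lemma \<open>A_tau_approx\<close>), and integration against a finite measure is
  continuous for the uniform norm, so multiplicativity extends to \<open>A_tau\<close>
  (lemma \<open>integral_mult_A_tau\<close>).

  Density comes from convolution: convolving \<open>f\<close> with a normalized bump at the identity changes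
  \<open>f\<close> little in the uniform norm, and by Stone and Weierstrass the bump may be replaced by a
  trigonometric polynomial. The convolution of \<open>f\<close> with a trigonometric polynomial is a
  trigonometric polynomial whose frequencies lie in the spectrum of \<open>f\<close>.

  The remaining work is to see that \<open>haar\<close> and \<open>poisson\<close>, which are given by definite descriptions,
  denote the intended measures. Uniqueness holds because a finite measure on the torus is
  determined by its Fourier coefficients, again by Stone and Weierstrass. Haar measure, which is
  also the Poisson measure for \<open>\<sigma> = \<infinity>\<close>, is the image of an infinite product of uniform
  distributions. For finite \<open>\<sigma>\<close> the Poisson measure is the image of the Cauchy distribution on
  the line under \<open>t \<mapsto> (p\<^sub>k\<^sup>i\<^sup>\<sigma>\<^sup>t)\<^sub>k\<close>: on this curve \<open>\<gamma>\<^sub>n\<close> becomes \<open>exp (i \<sigma> tau(n) t)\<close>, and the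
  characteristic function of the Cauchy distribution is \<open>exp (- \<bar>s\<bar>)\<close>.
\<close>

section \<open>Characters of the torus\<close>

lemma torus_nonzero: "x \<in> torus \<Longrightarrow> x k \<noteq> 0"
  by (metis (mono_tags) mem_Collect_eq norm_zero torus_def zero_neq_one)

lemma cnj_torus: "x \<in> torus \<Longrightarrow> cnj (x k) = inverse (x k)"
  using complex_norm_square[of "x k"] torus_nonzero[of x k]
  by (simp add: torus_def field_simps)

lemma torus_inverse_in_torus: "x \<in> torus \<Longrightarrow> torus_inverse x \<in> torus"
  by (simp add: torus_def torus_inverse_def norm_inverse)

lemma torus_mult_commute: "torus_mult x y = torus_mult y x"
  by (simp add: torus_mult_def mult.commute)

lemma torus_mult_one [simp]: "torus_mult x (\<lambda>_. 1) = x"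
  by (simp add: torus_mult_def)

lemma one_in_torus: "(\<lambda>_. 1) \<in> torus"
  by (simp add: torus_def)

lemma character_eq_prod:
  assumes "finite K" "Poly_Mapping.keys n \<subseteq> K"
  shows "character n x = (\<Prod>k\<in>K. x k powi Poly_Mapping.lookup n k)"
  unfolding character_def
  using assms by (intro prod.mono_neutral_left) (auto simp: in_keys_iff)

lemma tau_eq_sum:
  assumes "finite K" "Poly_Mapping.keys n \<subseteq> K"
  shows "tau n = (\<Sum>k\<in>K. real_of_int (Poly_Mapping.lookup n k) * ln (real (nth_prime k)))"
  unfolding tau_def
  using assms by (intro sum.mono_neutral_left) (auto simp: in_keys_iff)

lemma character_0 [simp]: "character 0 = (\<lambda>_. 1)"
  by (simp add: character_def fun_eq_iff)

lemma character_single: "character (Poly_Mapping.single k 1) = (\<lambda>x. x k)"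
  by (simp add: character_def fun_eq_iff)

lemma character_add:
  assumes "x \<in> torus"
  shows "character (n + m) x = character n x * character m x"
proof -
  let ?K = "Poly_Mapping.keys n \<union> Poly_Mapping.keys m"
  have "character (n + m) x = (\<Prod>k\<in>?K. x k powi Poly_Mapping.lookup (n + m) k)"
    using Poly_Mapping.keys_add[of n m] by (intro character_eq_prod) auto
  also have "\<dots> = (\<Prod>k\<in>?K. x k powi Poly_Mapping.lookup n k) * (\<Prod>k\<in>?K. x k powi Poly_Mapping.lookup m k)"
    using torus_nonzero[OF assms]
    by (simp add: lookup_add power_int_add prod.distrib)
  also have "\<dots> = character n x * character m x"
    by (simp add: character_eq_prod[where K = ?K])
  finally show ?thesis .
qed

lemma tau_add: "tau (n + m) = tau n + tau m"
proof -
  let ?K = "Poly_Mapping.keys n \<union> Poly_Mapping.keys m"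
  have "tau (n + m) = (\<Sum>k\<in>?K. real_of_int (Poly_Mapping.lookup (n + m) k) * ln (real (nth_prime k)))"
    using Poly_Mapping.keys_add[of n m] by (intro tau_eq_sum) auto
  also have "\<dots> = tau n + tau m"
    by (simp add: tau_eq_sum[where K = ?K] lookup_add distrib_right sum.distrib)
  finally show ?thesis .
qed

lemma tau_0 [simp]: "tau 0 = 0"
  by (simp add: tau_def)

lemma tau_uminus: "tau (- n) = - tau n"
  using tau_add[of n "- n"] by simp

lemma character_uminus: "x \<in> torus \<Longrightarrow> character (- n) x = cnj (character n x)"
  by (simp add: character_def cnj_torus power_int_inverse power_int_minus)

lemma norm_character: "x \<in> torus \<Longrightarrow> norm (character n x) = 1"
  by (simp add: character_def torus_def norm_power_int flip: prod_norm)

lemma character_mult: "character n (torus_mult x y) = character n x * character n y"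
  by (simp add: character_def torus_mult_def power_int_mult_distrib prod.distrib)

lemma continuous_on_character [continuous_intros]: "continuous_on torus (character n)"
  unfolding character_def
  by (intro continuous_intros continuous_on_subset[OF continuous_on_product_coordinates])
    (auto dest: torus_nonzero)

section \<open>Integration over the torus\<close>

lemma compact_torus: "compact torus"
proof -
  have "torus = (\<Pi>\<^sub>E i\<in>UNIV. sphere 0 (1::real))"
    by (auto simp: torus_def PiE_iff)
  moreover have "compactin (product_topology (\<lambda>_::nat. euclidean) UNIV) (\<Pi>\<^sub>E i\<in>UNIV. sphere (0::complex) (1::real))"
    by (subst compactin_PiE) auto
  ultimately show ?thesis
    by (simp add: euclidean_product_topology)
qed

lemma space_torus_borel [simp]: "space torus_borel = torus"
  by (simp add: torus_borel_def space_restrict_space)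

locale torus_measure = finite_measure M for M :: "(nat \<Rightarrow> complex) measure" +
  assumes sets_M: "sets M = sets torus_borel"
begin

lemma space_M: "space M = torus"
  using sets_eq_imp_space_eq[OF sets_M] by simp

lemma measurable_continuous:
  fixes f :: "(nat \<Rightarrow> complex) \<Rightarrow> 'b :: topological_space"
  shows "continuous_on torus f \<Longrightarrow> f \<in> borel_measurable M"
  using borel_measurable_continuous_on_restrict[of torus f]
  by (simp add: measurable_cong_sets[OF sets_M refl] torus_borel_def)

lemma integrable_continuous:
  fixes f :: "(nat \<Rightarrow> complex) \<Rightarrow> 'b :: {banach, second_countable_topology}"
  assumes "continuous_on torus f"
  shows "integrable M f"
proof -
  obtain B where B: "\<And>x. x \<in> torus \<Longrightarrow> norm (f x) \<le> B"
    using compact_imp_bounded[OF compact_continuous_image[OF assms compact_torus]]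
    by (auto simp: bounded_iff)
  show ?thesis
    using B measurable_continuous[OF assms]
    by (intro integrable_const_bound[where B = B]) (auto simp: space_M intro!: AE_I2)
qed

lemma norm_integral_le:
  fixes f :: "(nat \<Rightarrow> complex) \<Rightarrow> complex"
  assumes "continuous_on torus f" "\<And>x. x \<in> torus \<Longrightarrow> norm (f x) \<le> e"
  shows "norm (LINT x|M. f x) \<le> e * measure M torus"
proof -
  have "norm (LINT x|M. f x) \<le> (LINT x|M. norm (f x))"
    by simp
  also have "\<dots> \<le> (LINT x|M. e)"
    using assms by (intro integral_mono integrable_continuous continuous_intros) (auto simp: space_M)
  finally show ?thesis
    by (simp add: space_M mult.commute)
qed

lemma torus_measure_translate:
  assumes "l \<in> torus" shows "torus_measure (translate l M)"
proof -
  have "(\<lambda>x. torus_mult x l) \<in> measurable M torus_borel"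
    using measurable_torus_mult[OF assms] by (simp add: measurable_cong_sets[OF sets_M refl])
  then have "finite_measure (translate l M)"
    unfolding translate_def by (rule finite_measure_distr)
  then show ?thesis
    by (intro torus_measure.intro) (auto simp: torus_measure_axioms_def translate_def)
qed

lemma integral_translate:
  fixes f :: "(nat \<Rightarrow> complex) \<Rightarrow> complex"
  assumes "l \<in> torus" "continuous_on torus f"
  shows "(LINT x|translate l M. f x) = (LINT x|M. f (torus_mult x l))"
proof -
  have "(\<lambda>x. torus_mult x l) \<in> measurable M torus_borel"
    using measurable_torus_mult[OF assms(1)] by (simp add: measurable_cong_sets[OF sets_M refl])
  then show ?thesis
    unfolding translate_def using borel_measurable_continuous_on_restrict[OF assms(2)]
    by (intro integral_distr) (auto simp: torus_borel_def)
qed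

lemma integral_character: "(LINT x|M. character n x) = cnj (fourier_measure M n)"
  by (simp add: fourier_measure_def flip: integral_cnj)

text \<open>
  Translating a measure only multiplies its Fourier coefficients by unimodular constants. Applied
  to a translation invariant measure this forces all but one of them to vanish; applied to Poisson
  measures it reduces the theorem to the coefficients of the untranslated measure.
\<close>

lemma fourier_translate:
  assumes "l \<in> torus"
  shows "fourier_measure (translate l M) n = cnj (character n l) * fourier_measure M n"
  unfolding fourier_measure_def using assms
  by (subst integral_translate) (auto intro!: continuous_intros simp: character_mult mult.commute)

end

section \<open>Trigonometric polynomials and uniqueness of measures\<close>

text \<open>
  Linear combinations of characters with exponents in \<open>S\<close>. The inductive form gives induction over
  the number of terms; equality is required on the torus only, because the rules for products and
  conjugates of characters fail elsewhere.
\<close>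

inductive trig_poly :: "(nat \<Rightarrow>\<^sub>0 int) set \<Rightarrow> ((nat \<Rightarrow> complex) \<Rightarrow> complex) \<Rightarrow> bool" for S where
  zero: "(\<And>x. x \<in> torus \<Longrightarrow> f x = 0) \<Longrightarrow> trig_poly S f"
| step: "n \<in> S \<Longrightarrow> trig_poly S p \<Longrightarrow> (\<And>x. x \<in> torus \<Longrightarrow> f x = c * character n x + p x) \<Longrightarrow> trig_poly S f"

lemma trig_poly_cong:
  assumes "trig_poly S f" "\<And>x. x \<in> torus \<Longrightarrow> g x = f x"
  shows "trig_poly S g"
  using assms by cases (auto intro: trig_poly.intros)

lemma trig_poly_continuous: "trig_poly S f \<Longrightarrow> continuous_on torus f"
proof (induction rule: trig_poly.induct)
  case (zero f)
  then show ?case by (subst continuous_on_cong[where g = "\<lambda>_. 0"]) auto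
next
  case (step n p f c)
  have "continuous_on torus (\<lambda>x. c * character n x + p x)"
    by (intro continuous_intros step)
  then show ?case
    using step by (subst continuous_on_cong[OF refl, where g = "\<lambda>x. c * character n x + p x"]) auto
qed

lemma trig_poly_add: "trig_poly S f \<Longrightarrow> trig_poly S g \<Longrightarrow> trig_poly S (\<lambda>x. f x + g x)"
proof (induction rule: trig_poly.induct)
  case (zero f)
  from zero(2) show ?case by (rule trig_poly_cong) (simp add: zero(1))
next
  case (step n p f c)
  show ?case
    by (rule trig_poly.step[where n = n and c = c and p = "\<lambda>x. p x + g x"]) (use step in auto)
qed

lemma trig_poly_cmult: "trig_poly S f \<Longrightarrow> trig_poly S (\<lambda>x. c * f x)"
proof (induction rule: trig_poly.induct)
  case (zero f)
  then show ?case by (auto intro: trig_poly.zero)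
next
  case (step n p f d)
  show ?case
    by (rule trig_poly.step[where n = n and c = "c * d" and p = "\<lambda>x. c * p x"])
      (use step in \<open>auto simp: algebra_simps\<close>)
qed

lemma trig_poly_character: "n \<in> S \<Longrightarrow> trig_poly S (character n)"
  by (rule trig_poly.step[where n = n and c = 1 and p = "\<lambda>_. 0"]) (auto intro: trig_poly.zero)

lemma trig_poly_const: "trig_poly UNIV (\<lambda>_. c)"
  using trig_poly_cmult[OF trig_poly_character[of 0 UNIV], of c] by simp

lemma trig_poly_mult:
  assumes "trig_poly UNIV f" "trig_poly UNIV g"
  shows "trig_poly UNIV (\<lambda>x. f x * g x)"
proof -
  have char: "trig_poly UNIV (\<lambda>x. character n x * g x)" for n
    using assms(2)
  proof (induction rule: trig_poly.induct)
    case (zero f)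
    then show ?case by (auto intro: trig_poly.zero)
  next
    case (step m p f c)
    show ?case
      by (rule trig_poly.step[where n = "n + m" and c = c and p = "\<lambda>x. character n x * p x"])
        (use step in \<open>auto simp: algebra_simps character_add\<close>)
  qed
  show ?thesis
    using assms(1)
  proof (induction rule: trig_poly.induct)
    case (zero f)
    then show ?case by (auto intro: trig_poly.zero)
  next
    case (step m p f c)
    have "trig_poly UNIV (\<lambda>x. c * (character m x * g x) + p x * g x)"
      by (intro trig_poly_add trig_poly_cmult char step)
    then show ?case
      by (rule trig_poly_cong) (simp add: step algebra_simps)
  qed
qed

lemma trig_poly_cnj: "trig_poly UNIV f \<Longrightarrow> trig_poly UNIV (\<lambda>x. cnj (f x))"
proof (induction rule: trig_poly.induct)
  case (zero f)
  then show ?case by (auto intro: trig_poly.zero)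
next
  case (step n p f c)
  show ?case
    by (rule trig_poly.step[where n = "- n" and c = "cnj c" and p = "\<lambda>x. cnj (p x)"])
      (use step in \<open>auto simp: character_uminus\<close>)
qed

text \<open>
  The real-valued functions that agree on the torus with a trigonometric polynomial form an
  algebra. It separates points, because the real and imaginary parts of the coordinates belong to
  it, so the Stone-Weierstrass theorem applies.
\<close>

lemma trig_poly_dense:
  fixes f :: "(nat \<Rightarrow> complex) \<Rightarrow> real"
  assumes "continuous_on torus f" "0 < e"
  obtains q where "trig_poly UNIV q" "\<And>x. x \<in> torus \<Longrightarrow> norm (of_real (f x) - q x) < e"
proof -
  have re: "trig_poly UNIV (\<lambda>x. of_real (Re (x k)))"
    and im: "trig_poly UNIV (\<lambda>x. of_real (Im (x k)))" for k
  proof -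
    have c: "trig_poly UNIV (\<lambda>x. x k)"
      using trig_poly_character[of "Poly_Mapping.single k 1" UNIV] by (simp add: character_single)
    have "trig_poly UNIV (\<lambda>x. (1/2) * (x k + cnj (x k)))"
      by (intro trig_poly_cmult trig_poly_add trig_poly_cnj c)
    then show "trig_poly UNIV (\<lambda>x. of_real (Re (x k)))"
      by (rule trig_poly_cong) (simp add: complex_eq_iff)
    have "trig_poly UNIV (\<lambda>x. (- \<i>/2) * (x k + (-1) * cnj (x k)))"
      by (intro trig_poly_cmult trig_poly_add trig_poly_cnj c)
    then show "trig_poly UNIV (\<lambda>x. of_real (Im (x k)))"
      by (rule trig_poly_cong) (simp add: complex_eq_iff)
  qed
  have "\<exists>g::(nat \<Rightarrow> complex) \<Rightarrow> real. trig_poly UNIV (\<lambda>x. of_real (g x)) \<and> (\<forall>x\<in>torus. \<bar>f x - g x\<bar> < e)"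
  proof (rule Stone_Weierstrass_HOL[OF compact_torus])
    fix g :: "(nat \<Rightarrow> complex) \<Rightarrow> real" assume "trig_poly UNIV (\<lambda>x. of_real (g x))"
    from continuous_on_Re[OF trig_poly_continuous[OF this]] show "continuous_on torus g" by simp
  next
    fix x y :: "nat \<Rightarrow> complex" assume "x \<in> torus \<and> y \<in> torus \<and> x \<noteq> y"
    then obtain k where "x k \<noteq> y k" by auto
    then have "Re (x k) \<noteq> Re (y k) \<or> Im (x k) \<noteq> Im (y k)" by (simp add: complex_eq_iff)
    then show "\<exists>g::(nat \<Rightarrow> complex) \<Rightarrow> real. trig_poly UNIV (\<lambda>x. of_real (g x)) \<and> g x \<noteq> g y"
      using re[of k] im[of k] by (meson)
  qed (use assms in \<open>auto intro: trig_poly_const trig_poly_add trig_poly_mult\<close>)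
  then obtain g :: "(nat \<Rightarrow> complex) \<Rightarrow> real"
    where "trig_poly UNIV (\<lambda>x. of_real (g x))" "\<forall>x\<in>torus. \<bar>f x - g x\<bar> < e" by blast
  then show thesis
    by (intro that[of "\<lambda>x. of_real (g x)"]) (auto simp flip: of_real_diff)
qed

lemma (in torus_measure) integral_mult_trig_poly_eq_0:
  assumes w: "continuous_on torus w"
    and 0: "\<And>n. n \<in> S \<Longrightarrow> (LINT x|M. w x * character n x) = 0"
    and "trig_poly S q"
  shows "(LINT x|M. w x * q x) = 0"
  using assms(3)
proof (induction rule: trig_poly.induct)
  case (zero f)
  then have "(LINT x|M. w x * f x) = (LINT x|M. 0)"
    by (intro Bochner_Integration.integral_cong) (auto simp: space_M)
  then show ?case by simp
next
  case (step n p f c)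
  have "(LINT x|M. w x * f x) = (LINT x|M. c * (w x * character n x) + w x * p x)"
    using step by (intro Bochner_Integration.integral_cong) (auto simp: space_M algebra_simps)
  also have "\<dots> = c * (LINT x|M. w x * character n x) + (LINT x|M. w x * p x)"
    using w trig_poly_continuous[OF step(2)]
    by (subst Bochner_Integration.integral_add)
      (auto intro!: integrable_continuous continuous_intros)
  finally show ?case using 0[OF step(1)] step by simp
qed

text \<open>
  The functional \<open>f \<mapsto> \<integral> w f\<close> is linear and bounded in the uniform norm, so it vanishes on the closed
  span of the characters that it annihilates. This is how identities between characters are
  passed on to uniform limits of trigonometric polynomials.
\<close>

lemma (in torus_measure) integral_mult_eq_0_if_approximable:
  assumes w: "continuous_on torus w" and f: "continuous_on torus f"
    and 0: "\<And>n. n \<in> S \<Longrightarrow> (LINT x|M. w x * character n x) = 0"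
    and approx: "\<And>e. 0 < e \<Longrightarrow> \<exists>q. trig_poly S q \<and> (\<forall>x\<in>torus. norm (f x - q x) \<le> e)"
  shows "(LINT x|M. w x * f x) = 0"
proof -
  obtain B where B: "\<And>x. x \<in> torus \<Longrightarrow> norm (w x) \<le> B"
    using compact_imp_bounded[OF compact_continuous_image[OF w compact_torus]]
    by (auto simp: bounded_iff)
  have "0 \<le> B"
    using B[OF one_in_torus] norm_ge_zero order_trans by blast
  define C where "C = B * measure M torus + 1"
  have "C > 0" using \<open>0 \<le> B\<close> by (simp add: C_def add_nonneg_pos)
  have "norm (LINT x|M. w x * f x) \<le> e" if "e > 0" for e
  proof -
    obtain q where q: "trig_poly S q" "\<And>x. x \<in> torus \<Longrightarrow> norm (f x - q x) \<le> e / C"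
      using approx[of "e / C"] \<open>e > 0\<close> \<open>C > 0\<close> by auto
    note [continuous_intros] = w f trig_poly_continuous[OF q(1)]
    have "(LINT x|M. w x * f x) = (LINT x|M. w x * q x + w x * (f x - q x))"
      by (simp add: algebra_simps)
    also have "\<dots> = (LINT x|M. w x * q x) + (LINT x|M. w x * (f x - q x))"
      by (intro Bochner_Integration.integral_add integrable_continuous continuous_intros)
    also have "\<dots> = (LINT x|M. w x * (f x - q x))"
      using integral_mult_trig_poly_eq_0[OF w 0 q(1)] by simp
    also have "norm \<dots> \<le> (B * (e / C)) * measure M torus"
      using B q(2) \<open>0 \<le> B\<close>
      by (intro norm_integral_le continuous_intros) (auto simp: norm_mult simp del: times_divide_eq_right intro: mult_mono)
    also have "\<dots> = e * ((C - 1) / C)"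
      by (simp add: C_def)
    also have "\<dots> \<le> e"
      using \<open>C > 0\<close> \<open>e > 0\<close> by (simp add: field_simps)
    finally show ?thesis .
  qed
  then have "norm (LINT x|M. w x * f x) \<le> 0"
    by (rule field_le_epsilon) (simp del: norm_le_zero_iff)
  then show ?thesis by simp
qed

text \<open>
  The Fourier coefficients determine the integrals of trigonometric polynomials, and these are
  uniformly dense among the continuous functions.
\<close>

lemma integral_eq_if_fourier_measure_eq:
  fixes f :: "(nat \<Rightarrow> complex) \<Rightarrow> real"
  assumes M: "torus_measure M" and N: "torus_measure N"
    and eq: "\<And>n. fourier_measure M n = fourier_measure N n"
    and f: "continuous_on torus f"
  shows "(LINT x|M. f x) = (LINT x|N. f x)"
proof -
  interpret M: torus_measure M by fact
  interpret N: torus_measure N by fact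
  have trig: "(LINT x|M. q x) = (LINT x|N. q x)" if "trig_poly UNIV q" for q
    using that
  proof (induction rule: trig_poly.induct)
    case (zero f)
    then have "(LINT x|M. f x) = (LINT x|M. 0)" "(LINT x|N. f x) = (LINT x|N. 0)"
      by (intro Bochner_Integration.integral_cong; simp add: M.space_M N.space_M)+
    then show ?case by simp
  next
    case (step n p f c)
    note [continuous_intros] = trig_poly_continuous[OF step(2)]
    have "(LINT x|M. f x) = (LINT x|M. c * character n x + p x)"
      "(LINT x|N. f x) = (LINT x|N. c * character n x + p x)"
      using step by (intro Bochner_Integration.integral_cong; simp add: M.space_M N.space_M)+
    moreover have "(LINT x|M. c * character n x + p x) = c * (LINT x|M. character n x) + (LINT x|M. p x)"
      by (subst Bochner_Integration.integral_add)
        (auto intro!: M.integrable_continuous continuous_intros)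
    moreover have "(LINT x|N. c * character n x + p x) = c * (LINT x|N. character n x) + (LINT x|N. p x)"
      by (subst Bochner_Integration.integral_add)
        (auto intro!: N.integrable_continuous continuous_intros)
    ultimately show ?case
      using step by (simp add: M.integral_character N.integral_character eq)
  qed
  define C where "C = measure M torus + measure N torus + 1"
  have "C > 0" by (simp add: C_def add_nonneg_pos)
  have "norm ((LINT x|M. complex_of_real (f x)) - (LINT x|N. complex_of_real (f x))) \<le> e" if "e > 0" for e
  proof -
    obtain q where q: "trig_poly UNIV q" "\<And>x. x \<in> torus \<Longrightarrow> norm (of_real (f x) - q x) < e / C"
      using trig_poly_dense[OF f, of "e / C"] \<open>e > 0\<close> \<open>C > 0\<close> by auto
    note [continuous_intros] = f trig_poly_continuous[OF q(1)]
    have "(LINT x|M. of_real (f x) - q x) = (LINT x|M. complex_of_real (f x)) - (LINT x|M. q x)"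
      by (intro Bochner_Integration.integral_diff M.integrable_continuous continuous_intros)
    moreover have "(LINT x|N. of_real (f x) - q x) = (LINT x|N. complex_of_real (f x)) - (LINT x|N. q x)"
      by (intro Bochner_Integration.integral_diff N.integrable_continuous continuous_intros)
    ultimately have "norm ((LINT x|M. complex_of_real (f x)) - (LINT x|N. complex_of_real (f x)))
        = norm ((LINT x|M. of_real (f x) - q x) - (LINT x|N. of_real (f x) - q x))"
      using trig[OF q(1)] by simp
    also have "\<dots> \<le> norm (LINT x|M. of_real (f x) - q x) + norm (LINT x|N. of_real (f x) - q x)"
      by (rule norm_triangle_ineq4)
    also have "\<dots> \<le> e / C * measure M torus + e / C * measure N torus"
      using q(2) by (intro add_mono M.norm_integral_le N.norm_integral_le continuous_intros)
        (auto intro: less_imp_le)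
    also have "\<dots> = e * ((C - 1) / C)"
      by (simp add: C_def algebra_simps add_divide_distrib)
    also have "\<dots> \<le> e"
      using \<open>C > 0\<close> \<open>e > 0\<close> by (simp add: field_simps)
    finally show ?thesis .
  qed
  then have "norm ((LINT x|M. complex_of_real (f x)) - (LINT x|N. complex_of_real (f x))) \<le> 0"
    by (rule field_le_epsilon) (simp del: norm_le_zero_iff)
  then show ?thesis by simp
qed

text \<open>
  Continuous functions determine the measure of a closed set: its indicator is the bounded
  pointwise limit of the functions \<open>max 0 (1 - j * infdist x C)\<close>. The closed sets form a generator of
  the Borel sets that is stable under intersection.
\<close>

lemma torus_measure_eqI:
  assumes M: "torus_measure M" and N: "torus_measure N"
    and eq: "\<And>n. fourier_measure M n = fourier_measure N n"
  shows "M = N"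
proof -
  interpret M: torus_measure M by fact
  interpret N: torus_measure N by fact
  define E where "E = (\<lambda>C. C \<inter> torus) ` {C. closed (C :: (nat \<Rightarrow> complex) set)}"
  have closed: "measure M (C \<inter> torus) = measure N (C \<inter> torus)" if C: "closed C" for C
  proof (cases "C = {}")
    case False
    define h where "h j x = max 0 (1 - real j * infdist x C)" for j and x :: "nat \<Rightarrow> complex"
    have h_cont: "continuous_on torus (h j)" for j
      unfolding h_def by (intro continuous_intros)
    have h_bound: "norm (h j x) \<le> 1" for j x
      by (simp add: h_def infdist_nonneg)
    have h_lim: "(\<lambda>j. h j x) \<longlonglongrightarrow> indicator C x" for x
    proof (cases "x \<in> C")
      case True
      then show ?thesis by (simp add: h_def)
    next
      case x: False
      then have pos: "infdist x C > 0"
        using in_closed_iff_infdist_zero[OF C False] infdist_nonneg[of x C] by force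
      obtain J :: nat where J: "1 < real J * infdist x C"
        using reals_Archimedean3[OF pos] by auto
      have "h j x = 0" if "j \<ge> J" for j
      proof -
        have "real J * infdist x C \<le> real j * infdist x C"
          using that pos by (intro mult_right_mono) auto
        then show ?thesis using J by (simp add: h_def)
      qed
      then show ?thesis
        using x by (auto intro!: tendsto_eventually eventually_sequentiallyI[of J])
    qed
    have lim: "(\<lambda>j. LINT x|L. h j x) \<longlonglongrightarrow> measure L (C \<inter> torus)" if "torus_measure L" for L
    proof -
      interpret L: torus_measure L by fact
      have CL: "C \<inter> torus \<in> sets L"
        using C by (auto simp: L.sets_M torus_borel_def sets_restrict_space)
      have "(\<lambda>j. LINT x|L. h j x) \<longlonglongrightarrow> (LINT x|L. indicator (C \<inter> torus) x)"
      proof (rule integral_dominated_convergence[where w = "\<lambda>_. 1"])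
        show "AE x in L. (\<lambda>j. h j x) \<longlonglongrightarrow> indicator (C \<inter> torus) x"
          using h_lim by (intro AE_I2) (simp add: L.space_M indicator_def)
      qed (use L.measurable_continuous[OF h_cont] CL h_bound in auto)
      then show ?thesis using CL by (simp add: L.space_M Int_absorb1)
    qed
    have "(LINT x|M. h j x) = (LINT x|N. h j x)" for j
      by (rule integral_eq_if_fourier_measure_eq[OF M N eq h_cont])
    then show ?thesis
      using lim[OF M] lim[OF N] LIMSEQ_unique by simp
  qed simp
  have sets_E: "sets torus_borel = sigma_sets torus E"
  proof -
    have "torus \<in> sigma_sets UNIV {C. closed (C :: (nat \<Rightarrow> complex) set)}"
      using compact_imp_closed[OF compact_torus] by (intro sigma_sets.Basic) simp
    then have "(\<inter>) torus ` sigma_sets UNIV {C. closed (C :: (nat \<Rightarrow> complex) set)}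
        = sigma_sets torus ((\<inter>) torus ` {C. closed C})"
      by (intro sigma_sets_Int) auto
    then show ?thesis
      by (simp add: torus_borel_def sets_restrict_space borel_eq_closed E_def Int_commute)
  qed
  have EM: "E \<subseteq> sets M"
    using sets_E M.sets_M by auto
  show ?thesis
  proof (rule measure_eqI_generator_eq[where E = E and \<Omega> = torus and A = "\<lambda>_. torus"])
    show "Int_stable E"
      unfolding E_def Int_stable_def
    proof safe
      fix a b :: "(nat \<Rightarrow> complex) set" assume "closed a" "closed b"
      then show "a \<inter> torus \<inter> (b \<inter> torus) \<in> (\<lambda>C. C \<inter> torus) ` {C. closed C}"
        by (intro image_eqI[where x = "a \<inter> b"]) auto
    qed
    show "range (\<lambda>_::nat. torus) \<subseteq> E"
      unfolding E_def by (auto intro!: image_eqI[where x = UNIV])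
    show "emeasure M X = emeasure N X" if "X \<in> E" for X
      using that closed unfolding E_def by (auto simp: M.emeasure_eq_measure N.emeasure_eq_measure)
  qed (use sets_E in \<open>auto simp: E_def M.sets_M N.sets_M M.emeasure_eq_measure\<close>)
qed

section \<open>Haar measure\<close>

lemma integral_circle_power:
  fixes m :: int
  assumes "m \<noteq> 0"
  shows "(LINT t|uniform_measure lborel {0..1}. cis (2 * pi * t) powi m) = 0"
proof -
  let ?F = "\<lambda>t. cis (2 * pi * m * t) / (2 * pi * m * \<i>)"
  have U: "uniform_measure lborel {0..1} = density lborel (\<lambda>t::real. ennreal (indicator {0..1} t))"
    by (simp add: uniform_measure_def ennreal_indicator divide_ennreal_def)
  have "(LINT t|uniform_measure lborel {0..1}. cis (2 * pi * t) powi m)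
      = (LINT t|lborel. indicator {0..1} t *\<^sub>R cis (2 * pi * m * t))"
    unfolding U
    by (subst integral_density)
      (auto simp: cis_power_int mult_ac
        intro!: Bochner_Integration.integral_cong borel_measurable_continuous_onI continuous_intros)
  also have "\<dots> = ?F 1 - ?F 0"
  proof (rule integral_FTC_Icc)
    fix t :: real
    have "((\<lambda>t. cis (2 * pi * m * t)) has_vector_derivative (2 * pi * m) *\<^sub>R (\<i> * cis (2 * pi * m * t))) (at t within {0..1})"
      by (auto intro!: derivative_eq_intros simp: has_vector_derivative_complex_iff algebra_simps)
    from has_vector_derivative_divide[OF this, of "2 * pi * m * \<i>"]
    show "(?F has_vector_derivative cis (2 * pi * m * t)) (at t within {0..1})"
      using assms by (simp add: scaleR_conv_of_real)
  qed (auto intro!: continuous_intros)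
  also have "\<dots> = 0"
    using cis_multiple_2pi[of "real_of_int m"] by simp
  finally show ?thesis .
qed

text \<open>
  The Haar measure: countably many independent coordinates, each uniform on the circle.
\<close>

definition circle_product :: "(nat \<Rightarrow> complex) measure" where
  "circle_product = distr (PiM UNIV (\<lambda>_. uniform_measure lborel {0..1})) torus_borel
    (\<lambda>w k. cis (2 * pi * w k))"

text \<open>
  A character depends on finitely many coordinates, so its integral is a product of integrals of
  powers over single circles; one of the factors vanishes unless the exponent vector is \<open>0\<close>.
\<close>

lemma is_poisson_circle_product: "is_poisson \<infinity> circle_product"
proof -
  define U :: "real measure" where "U = uniform_measure lborel {0..1}"
  have U: "prob_space U"
    unfolding U_def by (rule prob_space_uniform_measure) auto
  interpret U: prob_space U by (rule U)
  interpret product_prob_space "\<lambda>_::nat. U" UNIV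
    by (simp add: U product_prob_spaceI)
  let ?P = "PiM UNIV (\<lambda>_::nat. U)" and ?h = "\<lambda>w::nat \<Rightarrow> real. \<lambda>k. cis (2 * pi * w k)"
  have sets_P: "sets ?P = sets borel"
  proof -
    have "sets ?P = sets (PiM UNIV (\<lambda>_::nat. borel :: real measure))"
      by (rule sets_PiM_cong) (auto simp: U_def)
    then show ?thesis by (simp add: sets_PiM_equal_borel)
  qed
  have h: "?h \<in> measurable ?P torus_borel"
  proof -
    have "?h \<in> borel_measurable borel"
      by (intro borel_measurable_continuous_onI continuous_on_coordinatewise_then_product
          continuous_intros continuous_on_product_coordinates)
    then show ?thesis
      unfolding torus_borel_def measurable_cong_sets[OF sets_P refl]
      by (intro measurable_restrict_space2) (auto simp: torus_def)
  qed
  interpret H: prob_space circle_product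
    unfolding circle_product_def U_def[symmetric] by (rule P.prob_space_distr[OF h])
  have tm: "torus_measure circle_product"
    by (intro torus_measure.intro H.finite_measure_axioms)
      (simp add: torus_measure_axioms_def circle_product_def)
  interpret H: torus_measure circle_product by (rule tm)
  have coeff: "(LINT x|circle_product. character n x) = (if n = 0 then 1 else 0)" for n
  proof (cases "n = 0")
    case True
    then show ?thesis by (simp add: H.prob_space)
  next
    case False
    let ?K = "Poly_Mapping.keys n"
    let ?g = "\<lambda>k t. cis (2 * pi * t) powi Poly_Mapping.lookup n k"
    obtain k where k: "k \<in> ?K" using False by fastforce
    have g: "?g k \<in> borel_measurable U" for k
    proof -
      have "(\<lambda>t. cis (2 * pi * Poly_Mapping.lookup n k * t)) \<in> borel_measurable borel"
        by (intro borel_measurable_continuous_onI continuous_intros)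
      then show ?thesis by (simp add: U_def cis_power_int mult_ac)
    qed
    have int_g: "integrable U (?g k)" for k
      using g by (intro U.integrable_const_bound[where B = 1]) (auto simp: norm_power_int)
    \<comment> \<open>Pass to the finitely many coordinates that occur and split the integral there.\<close>
    have "(LINT x|circle_product. character n x) = (LINT w|?P. character n (?h w))"
      unfolding circle_product_def U_def[symmetric]
      using borel_measurable_continuous_on_restrict[OF continuous_on_character[of n]] h
      by (intro integral_distr) (auto simp: torus_borel_def)
    also have "\<dots> = (LINT w|?P. (\<Prod>k\<in>?K. ?g k (restrict w ?K k)))"
      by (auto simp: character_def intro!: Bochner_Integration.integral_cong prod.cong)
    also have "\<dots> = (LINT w|distr ?P (PiM ?K (\<lambda>_. U)) (\<lambda>w. restrict w ?K). (\<Prod>k\<in>?K. ?g k (w k)))"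
    proof (rule integral_distr[symmetric])
      show "(\<lambda>w. restrict w ?K) \<in> measurable ?P (PiM ?K (\<lambda>_. U))"
        by (rule measurable_restrict_subset) simp
      show "(\<lambda>w. \<Prod>k\<in>?K. ?g k (w k)) \<in> borel_measurable (PiM ?K (\<lambda>_. U))"
      proof (rule borel_measurable_prod)
        fix k assume "k \<in> ?K"
        then have "(\<lambda>w. w k) \<in> measurable (PiM ?K (\<lambda>_. U)) U"
          by (rule measurable_component_singleton)
        then show "(\<lambda>w. ?g k (w k)) \<in> borel_measurable (PiM ?K (\<lambda>_. U))"
          using g[of k] by (rule measurable_compose)
      qed
    qed
    also have "\<dots> = (LINT w|PiM ?K (\<lambda>_. U). (\<Prod>k\<in>?K. ?g k (w k)))"
      by (subst distr_PiM_restrict_finite) auto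
    also have "\<dots> = (\<Prod>k\<in>?K. integral\<^sup>L U (?g k))"
      using int_g by (intro product_integral_prod) auto
    also have "\<dots> = 0"
      using k integral_circle_power[of "Poly_Mapping.lookup n k"]
      by (intro prod_zero) (auto simp: U_def in_keys_iff)
    finally show ?thesis using False by simp
  qed
  have "fourier_measure circle_product n = (if n = 0 then 1 else 0)" for n
    using coeff[of n] by (simp add: H.integral_character split: if_splits)
  then show ?thesis
    unfolding is_poisson_def using H.finite_measure_axioms H.sets_M
    by (simp add: poisson_coeff_def)
qed

lemma torus_measure_if_is_poisson: "is_poisson s M \<Longrightarrow> torus_measure M"
  by (simp add: is_poisson_def torus_measure_def torus_measure_axioms_def)

lemma is_poisson_unique: "is_poisson s M \<Longrightarrow> is_poisson s N \<Longrightarrow> M = N"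
  by (intro torus_measure_eqI) (auto simp: torus_measure_if_is_poisson, simp add: is_poisson_def)

text \<open>
  Some translation \<open>l\<close> satisfies \<open>\<gamma>\<^sub>n(l) = -1\<close>, so by invariance the coefficient equals its own
  negative.
\<close>

lemma fourier_eq_0_if_is_haar:
  assumes "is_haar M" "n \<noteq> 0"
  shows "fourier_measure M n = 0"
proof -
  interpret prob_space M using assms by (simp add: is_haar_def)
  interpret torus_measure M
    using assms by unfold_locales (simp add: is_haar_def)
  obtain k where k: "k \<in> Poly_Mapping.keys n" using assms(2) by fastforce
  define j where "j = Poly_Mapping.lookup n k"
  have "j \<noteq> 0" using k by (simp add: j_def in_keys_iff)
  define l where "l = (\<lambda>i. if i = k then cis (pi / j) else 1)"
  have l: "l \<in> torus" by (simp add: l_def torus_def)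
  have "character n l = (\<Prod>i\<in>Poly_Mapping.keys n. if i = k then cis (pi / j) powi j else 1)"
    unfolding character_def by (intro prod.cong) (auto simp: l_def j_def)
  also have "\<dots> = -1"
    using k \<open>j \<noteq> 0\<close> by (simp add: cis_power_int)
  finally have "fourier_measure (translate l M) n = - fourier_measure M n"
    using l by (simp add: fourier_translate)
  moreover have "translate l M = M"
    using assms l by (simp add: is_haar_def)
  ultimately show ?thesis by simp
qed

text \<open>
  Both properties say that the coefficients are those of the trivial character. For the converse,
  a measure with these coefficients has the same coefficients as all its translates, hence is
  invariant.
\<close>

lemma is_haar_iff_is_poisson: "is_haar M \<longleftrightarrow> is_poisson \<infinity> M"
proof
  assume M: "is_haar M"
  then interpret prob_space M by (simp add: is_haar_def)
  show "is_poisson \<infinity> M"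
    using M fourier_eq_0_if_is_haar[OF M] finite_measure_axioms
    by (auto simp: is_haar_def is_poisson_def poisson_coeff_def fourier_measure_def prob_space)
next
  assume M: "is_poisson \<infinity> M"
  then interpret torus_measure M by (rule torus_measure_if_is_poisson)
  have coeff: "fourier_measure M n = (if n = 0 then 1 else 0)" for n
    using M by (simp add: is_poisson_def poisson_coeff_def)
  have "measure M (space M) = 1"
    using coeff[of 0] by (simp add: fourier_measure_def scaleR_conv_of_real)
  then have "prob_space M"
    by (intro prob_spaceI) (simp add: emeasure_eq_measure)
  moreover have "translate l M = M" if "l \<in> torus" for l
    using that
    by (intro torus_measure_eqI torus_measure_translate torus_measure_axioms)
      (simp_all add: fourier_translate coeff)
  ultimately show "is_haar M" by (simp add: is_haar_def sets_M)
qed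

lemma is_haar_haar: "is_haar haar"
  unfolding haar_def
  using is_poisson_circle_product is_poisson_unique
  by (intro theI'[of is_haar]) (auto simp: is_haar_iff_is_poisson)

section \<open>The Cauchy distribution\<close>

text \<open>
  The characteristic function of the Cauchy distribution follows by Fourier inversion from the
  transform \<open>2 / (1 + t\<^sup>2)\<close> of \<open>exp (- \<bar>u\<bar>)\<close>. As usual, the inversion is made absolutely convergent by
  a Gaussian factor of width \<open>1 / e\<close>, which is removed by letting \<open>e\<close> tend to \<open>0\<close>.
\<close>

lemma integrable_exp_minus_abs: "integrable lborel (\<lambda>u::real. exp (- \<bar>u\<bar>))"
proof -
  have 1: "integrable lborel (\<lambda>u::real. exp (- u) * indicator {0..} u)"
    using has_bochner_integral_I0i_power_exp_m'[of 0] by (simp add: integrable.intros)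
  have 2: "integrable lborel (\<lambda>u::real. exp u * indicator {0..} (- u))"
    using lborel_integrable_real_affine[OF 1, of "-1" 0] by simp
  show ?thesis
    by (rule Bochner_Integration.integrable_bound[OF Bochner_Integration.integrable_add[OF 1 2]])
      (auto split: split_indicator)
qed

text \<open>
  Folding the integral at \<open>0\<close> leaves twice the integral of \<open>exp (- u) * cos (t * u)\<close> over the half line,
  which has an elementary antiderivative.
\<close>

lemma fourier_transform_exp_minus_abs:
  "(CLINT u|lborel. exp (- \<bar>u\<bar>) *\<^sub>R iexp (t * u)) = 2 / (1 + t\<^sup>2)"
proof -
  let ?h = "\<lambda>u::real. exp (- \<bar>u\<bar>) *\<^sub>R iexp (t * u)"
  let ?c = "\<lambda>u. 2 * exp (- u) * cos (t * u)"
  let ?F = "\<lambda>u. 2 * exp (- u) * (t * sin (t * u) - cos (t * u)) / (1 + t\<^sup>2)"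
  have pos: "1 + t\<^sup>2 > 0" by (simp add: add_pos_nonneg)
  have meas [measurable]: "?h \<in> borel_measurable borel"
    by (intro borel_measurable_continuous_onI continuous_intros)
  have int: "integrable lborel ?h"
    by (rule Bochner_Integration.integrable_bound[OF integrable_exp_minus_abs]) auto
  have int1: "integrable lborel (\<lambda>u. indicator {0<..} u *\<^sub>R ?h u)"
    by (rule Bochner_Integration.integrable_bound[OF int]) (auto split: split_indicator)
  have int2: "integrable lborel (\<lambda>u. indicator {0<..} (- u) *\<^sub>R ?h u)"
    by (rule Bochner_Integration.integrable_bound[OF int]) (auto split: split_indicator)
  have int3: "integrable lborel (\<lambda>u. indicator {0<..} u *\<^sub>R ?h (- u))"
    using lborel_integrable_real_affine[OF int2, of "-1" 0] by simp
  have intc: "set_integrable lborel {0<..} ?c"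
    unfolding set_integrable_def
    by (rule Bochner_Integration.integrable_bound[OF integrable_mult_right[OF integrable_exp_minus_abs, of 2]])
      (auto split: split_indicator simp: abs_mult intro!: mult_left_le)
  have "(LBINT u=0..\<infinity>. ?c u) = 0 - ?F 0"
  proof (rule interval_integral_FTC_integrable[where F = ?F])
    show "(?F has_vector_derivative ?c u) (at u)" for u
    proof -
      have "((\<lambda>u. 2 * exp (- u) * (t * sin (t * u) - cos (t * u))) has_real_derivative ?c u * (1 + t\<^sup>2)) (at u)"
        by (auto intro!: derivative_eq_intros simp: algebra_simps power2_eq_square)
      from DERIV_cdivide[OF this, of "1 + t\<^sup>2"] show ?thesis
        unfolding has_real_derivative_iff_has_vector_derivative[symmetric] using pos by simp
    qed
    show "set_integrable lborel (einterval 0 \<infinity>) ?c"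
      using intc by (simp add: zero_ereal_def)
    have "(?F \<longlongrightarrow> ?F 0) (at_right 0)"
      using pos by (intro tendsto_intros) auto
    then show "((?F \<circ> real_of_ereal) \<longlongrightarrow> ?F 0) (at_right 0)"
      by (simp add: zero_ereal_def ereal_tendsto_simps)
    have "(?F \<longlongrightarrow> 0) at_top"
    proof (rule Lim_null_comparison)
      show "\<forall>\<^sub>F u in at_top. norm (?F u) \<le> 2 * exp (- u) * (\<bar>t\<bar> + 1) / (1 + t\<^sup>2)"
      proof (intro always_eventually allI)
        fix u
        have "\<bar>t * sin (t * u) - cos (t * u)\<bar> \<le> \<bar>t * sin (t * u)\<bar> + \<bar>cos (t * u)\<bar>"
          by (rule abs_triangle_ineq4)
        also have "\<dots> \<le> \<bar>t\<bar> + 1"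
          by (intro add_mono) (auto simp: abs_mult intro: mult_left_le)
        finally show "norm (?F u) \<le> 2 * exp (- u) * (\<bar>t\<bar> + 1) / (1 + t\<^sup>2)"
          using pos by (simp add: abs_mult divide_right_mono)
      qed
      have "((\<lambda>u::real. exp (- u)) \<longlongrightarrow> 0) at_top"
        by (rule filterlim_compose[OF exp_at_bot filterlim_uminus_at_bot_at_top])
      then show "((\<lambda>u. 2 * exp (- u) * (\<bar>t\<bar> + 1) / (1 + t\<^sup>2)) \<longlongrightarrow> 0) at_top"
        by (intro tendsto_divide_zero tendsto_mult_left_zero tendsto_mult_right_zero)
    qed
    then show "((?F \<circ> real_of_ereal) \<longlongrightarrow> 0) (at_left \<infinity>)"
      by (simp add: ereal_tendsto_simps)
  qed (auto intro!: continuous_intros)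
  then have c: "(LINT u|lborel. indicator {0<..} u *\<^sub>R ?c u) = 2 / (1 + t\<^sup>2)"
    by (simp add: interval_lebesgue_integral_0_infty set_lebesgue_integral_def)
  have "(CLINT u|lborel. ?h u) = (CLINT u|lborel. indicator {0<..} u *\<^sub>R ?h u + indicator {0<..} (- u) *\<^sub>R ?h u)"
    using AE_lborel_singleton[of "0::real"]
    by (intro integral_cong_AE) (auto split: split_indicator)
  also have "\<dots> = (CLINT u|lborel. indicator {0<..} u *\<^sub>R ?h u) + (CLINT u|lborel. indicator {0<..} (- u) *\<^sub>R ?h u)"
    by (rule Bochner_Integration.integral_add[OF int1 int2])
  also have "(CLINT u|lborel. indicator {0<..} (- u) *\<^sub>R ?h u) = (CLINT u|lborel. indicator {0<..} u *\<^sub>R ?h (- u))"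
    by (subst lborel_integral_real_affine[where c = "-1" and t = 0]) auto
  also have "(CLINT u|lborel. indicator {0<..} u *\<^sub>R ?h u) + \<dots>
      = (CLINT u|lborel. indicator {0<..} u *\<^sub>R ?h u + indicator {0<..} u *\<^sub>R ?h (- u))"
    by (rule Bochner_Integration.integral_add[OF int1 int3, symmetric])
  also have "\<dots> = (CLINT u|lborel. of_real (indicator {0<..} u *\<^sub>R ?c u))"
    by (intro Bochner_Integration.integral_cong refl)
      (auto split: split_indicator simp: complex_eq_iff Re_exp Im_exp)
  also have "\<dots> = of_real (2 / (1 + t\<^sup>2))"
    by (simp only: integral_complex_of_real c)
  finally show ?thesis by simp
qed

lemma fourier_transform_std_normal_density:
  "(CLINT x|lborel. std_normal_density x *\<^sub>R iexp (s * x)) = of_real (exp (- s\<^sup>2 / 2))"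
proof -
  have "(CLINT x|lborel. std_normal_density x *\<^sub>R iexp (s * x)) = char std_normal_distribution s"
    unfolding char_def by (subst integral_density) auto
  then show ?thesis by (simp add: char_std_normal_distribution)
qed

text \<open>
  Insert the transform of \<open>exp (- \<bar>u\<bar>)\<close> for \<open>2 / (1 + t\<^sup>2)\<close> and integrate over \<open>t\<close> first: the Gaussian is
  its own transform up to scaling, so what remains is the average of \<open>exp (- \<bar>u\<bar>)\<close> over a normal
  distribution of standard deviation \<open>e\<close> around \<open>- s\<close>.
\<close>

lemma fourier_transform_cauchy_regularized:
  assumes "e > 0"
  shows "(CLINT t|lborel. (std_normal_density (e * t) * (2 / (1 + t\<^sup>2))) *\<^sub>R iexp (s * t))
     = of_real (LINT v|lborel. sqrt (2 * pi) * std_normal_density v * exp (- \<bar>e * v - s\<bar>))"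
proof -
  let ?k = "\<lambda>t u. (std_normal_density (e * t) * exp (- \<bar>u\<bar>)) *\<^sub>R iexp ((s + u) * t)"
  have n_int: "integrable lborel (\<lambda>t. std_normal_density (e * t))"
    using lborel_integrable_real_affine[of std_normal_density e 0] assms by simp
  have "integrable (lborel \<Otimes>\<^sub>M lborel) (\<lambda>(t, u). std_normal_density (e * t) * exp (- \<bar>u\<bar>))"
    using n_int integrable_exp_minus_abs
    by (intro lborel_pair.Fubini_integrable) (auto simp: abs_mult)
  then have k_int: "integrable (lborel \<Otimes>\<^sub>M lborel) (case_prod ?k)"
    by (rule Bochner_Integration.integrable_bound) (auto simp: abs_mult)
  have "(CLINT t|lborel. (std_normal_density (e * t) * (2 / (1 + t\<^sup>2))) *\<^sub>R iexp (s * t))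
      = (CLINT t|lborel. CLINT u|lborel. ?k t u)"
  proof (intro Bochner_Integration.integral_cong refl)
    fix t
    have "(CLINT u|lborel. ?k t u)
        = (CLINT u|lborel. (std_normal_density (e * t) *\<^sub>R iexp (s * t)) * (exp (- \<bar>u\<bar>) *\<^sub>R iexp (t * u)))"
      by (intro Bochner_Integration.integral_cong refl)
        (simp add: distrib_right distrib_left exp_add scaleR_conv_of_real mult_ac)
    also have "\<dots> = (std_normal_density (e * t) *\<^sub>R iexp (s * t)) * (2 / (1 + t\<^sup>2))"
      by (simp only: integral_mult_right_zero fourier_transform_exp_minus_abs)
    finally show "(std_normal_density (e * t) * (2 / (1 + t\<^sup>2))) *\<^sub>R iexp (s * t) = (CLINT u|lborel. ?k t u)"
      by (simp add: scaleR_conv_of_real mult_ac)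
  qed
  also have "\<dots> = (CLINT u|lborel. CLINT t|lborel. ?k t u)"
    by (rule lborel_pair.Fubini_integral[OF k_int, symmetric])
  also have "\<dots> = (CLINT u|lborel. of_real (exp (- \<bar>u\<bar>) * exp (- ((s + u) / e)\<^sup>2 / 2) / e))"
  proof (intro Bochner_Integration.integral_cong refl)
    fix u
    have "(CLINT t|lborel. ?k t u)
        = (CLINT t|lborel. of_real (exp (- \<bar>u\<bar>)) * (std_normal_density (e * t) *\<^sub>R iexp ((s + u) / e * (e * t))))"
      using assms by (intro Bochner_Integration.integral_cong refl) (simp add: scaleR_conv_of_real mult_ac)
    also have "\<dots> = of_real (exp (- \<bar>u\<bar>)) * (CLINT t|lborel. std_normal_density (e * t) *\<^sub>R iexp ((s + u) / e * (e * t)))"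
      by (rule integral_mult_right_zero)
    also have "(CLINT t|lborel. std_normal_density (e * t) *\<^sub>R iexp ((s + u) / e * (e * t)))
        = (1 / e) *\<^sub>R (CLINT x|lborel. std_normal_density x *\<^sub>R iexp ((s + u) / e * x))"
      using assms by (subst (2) lborel_integral_real_affine[where c = e and t = 0]) auto
    also have "\<dots> = (1 / e) *\<^sub>R of_real (exp (- ((s + u) / e)\<^sup>2 / 2))"
      by (simp only: fourier_transform_std_normal_density)
    finally show "(CLINT t|lborel. ?k t u) = of_real (exp (- \<bar>u\<bar>) * exp (- ((s + u) / e)\<^sup>2 / 2) / e)"
      by (simp add: scaleR_conv_of_real)
  qed
  also have "\<dots> = of_real (LINT u|lborel. exp (- \<bar>u\<bar>) * exp (- ((s + u) / e)\<^sup>2 / 2) / e)"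
    by (rule integral_complex_of_real)
  also have "(LINT u|lborel. exp (- \<bar>u\<bar>) * exp (- ((s + u) / e)\<^sup>2 / 2) / e)
      = (LINT v|lborel. sqrt (2 * pi) * std_normal_density v * exp (- \<bar>e * v - s\<bar>))"
    using assms
    by (subst lborel_integral_real_affine[where c = e and t = "- s"])
      (auto simp: std_normal_density_def field_simps simp flip: integral_mult_right_zero)
  finally show ?thesis .
qed

lemma integrable_inverse_1_plus_square_UNIV: "integrable lborel (\<lambda>t::real. 1 / (1 + t\<^sup>2))"
  using integrable_inverse_1_plus_square
  by (simp add: set_integrable_def inverse_eq_divide)

text \<open>
  Both sides of the regularized identity converge as \<open>e\<close> tends to \<open>0\<close>, by dominated convergence; the
  factor \<open>std_normal_density 0 = 1 / sqrt (2 * pi)\<close> that survives on the left is divided out.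
\<close>

lemma fourier_transform_inverse_1_plus_square:
  "(CLINT t|lborel. (1 / (1 + t\<^sup>2)) *\<^sub>R iexp (s * t)) = of_real (pi * exp (- \<bar>s\<bar>))"
proof -
  let ?e = "\<lambda>j::nat. 1 / real (Suc j)"
  have e0: "?e \<longlonglongrightarrow> 0"
    by (rule LIMSEQ_Suc[OF lim_1_over_n])
  have n_bound: "std_normal_density x \<le> std_normal_density 0" for x
    by (simp add: std_normal_density_def divide_right_mono)
  have pos: "1 + t\<^sup>2 > 0" for t :: real by (simp add: add_pos_nonneg)
  have "(\<lambda>j. CLINT t|lborel. (std_normal_density (?e j * t) * (2 / (1 + t\<^sup>2))) *\<^sub>R iexp (s * t))
      \<longlonglongrightarrow> (CLINT t|lborel. (std_normal_density 0 * (2 / (1 + t\<^sup>2))) *\<^sub>R iexp (s * t))"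
  proof (rule integral_dominated_convergence[where w = "\<lambda>t. std_normal_density 0 * (2 * (1 / (1 + t\<^sup>2)))"])
    show "integrable lborel (\<lambda>t::real. std_normal_density 0 * (2 * (1 / (1 + t\<^sup>2))))"
      by (intro integrable_mult_right integrable_inverse_1_plus_square_UNIV)
    show "AE t in lborel. (\<lambda>j. (std_normal_density (?e j * t) * (2 / (1 + t\<^sup>2))) *\<^sub>R iexp (s * t))
        \<longlonglongrightarrow> (std_normal_density 0 * (2 / (1 + t\<^sup>2))) *\<^sub>R iexp (s * t)"
    proof (rule AE_I2)
      fix t :: real
      have "(\<lambda>j. std_normal_density (?e j * t)) \<longlonglongrightarrow> std_normal_density (0 * t)"
        unfolding std_normal_density_def by (intro tendsto_intros e0) auto
      then show "(\<lambda>j. (std_normal_density (?e j * t) * (2 / (1 + t\<^sup>2))) *\<^sub>R iexp (s * t))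
        \<longlonglongrightarrow> (std_normal_density 0 * (2 / (1 + t\<^sup>2))) *\<^sub>R iexp (s * t)"
        by (intro tendsto_intros) simp
    qed
    show "AE t in lborel. norm ((std_normal_density (?e j * t) * (2 / (1 + t\<^sup>2))) *\<^sub>R iexp (s * t))
        \<le> std_normal_density 0 * (2 * (1 / (1 + t\<^sup>2)))" for j
      using n_bound pos by (intro AE_I2) (auto simp: abs_mult less_imp_le intro!: divide_right_mono)
  qed simp_all
  moreover have "(\<lambda>j. LINT v|lborel. sqrt (2 * pi) * std_normal_density v * exp (- \<bar>?e j * v - s\<bar>))
      \<longlonglongrightarrow> (LINT v|lborel. sqrt (2 * pi) * std_normal_density v * exp (- \<bar>s\<bar>))"
  proof (rule integral_dominated_convergence[where w = "\<lambda>v. sqrt (2 * pi) * std_normal_density v"])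
    show "AE v in lborel. (\<lambda>j. sqrt (2 * pi) * std_normal_density v * exp (- \<bar>?e j * v - s\<bar>))
        \<longlonglongrightarrow> sqrt (2 * pi) * std_normal_density v * exp (- \<bar>s\<bar>)"
    proof (rule AE_I2)
      fix v :: real
      have "(\<lambda>j. sqrt (2 * pi) * std_normal_density v * exp (- \<bar>?e j * v - s\<bar>))
        \<longlonglongrightarrow> sqrt (2 * pi) * std_normal_density v * exp (- \<bar>0 * v - s\<bar>)"
        by (intro tendsto_intros e0)
      then show "(\<lambda>j. sqrt (2 * pi) * std_normal_density v * exp (- \<bar>?e j * v - s\<bar>))
        \<longlonglongrightarrow> sqrt (2 * pi) * std_normal_density v * exp (- \<bar>s\<bar>)" by simp
    qed
    show "AE v in lborel. norm (sqrt (2 * pi) * std_normal_density v * exp (- \<bar>?e j * v - s\<bar>))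
        \<le> sqrt (2 * pi) * std_normal_density v" for j
      by (intro AE_I2) (auto simp: abs_mult intro!: mult_left_le)
  qed simp_all
  then have "(\<lambda>j. complex_of_real (LINT v|lborel. sqrt (2 * pi) * std_normal_density v * exp (- \<bar>?e j * v - s\<bar>)))
      \<longlonglongrightarrow> of_real (LINT v|lborel. sqrt (2 * pi) * std_normal_density v * exp (- \<bar>s\<bar>))"
    by (rule tendsto_of_real)
  ultimately have "(CLINT t|lborel. (std_normal_density 0 * (2 / (1 + t\<^sup>2))) *\<^sub>R iexp (s * t))
      = of_real (LINT v|lborel. sqrt (2 * pi) * std_normal_density v * exp (- \<bar>s\<bar>))"
    by (subst (asm) fourier_transform_cauchy_regularized) (auto dest: LIMSEQ_unique)
  also have "\<dots> = of_real (sqrt (2 * pi) * exp (- \<bar>s\<bar>))"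
    by simp
  also have "(CLINT t|lborel. (std_normal_density 0 * (2 / (1 + t\<^sup>2))) *\<^sub>R iexp (s * t))
      = (2 / sqrt (2 * pi)) *\<^sub>R (CLINT t|lborel. (1 / (1 + t\<^sup>2)) *\<^sub>R iexp (s * t))"
    by (simp add: std_normal_density_def flip: integral_scaleR_right)
  finally have "(CLINT t|lborel. (1 / (1 + t\<^sup>2)) *\<^sub>R iexp (s * t))
      = (sqrt (2 * pi) / 2) *\<^sub>R of_real (sqrt (2 * pi) * exp (- \<bar>s\<bar>))"
    by (simp add: scaleR_conv_of_real field_simps)
  also have "\<dots> = of_real (pi * exp (- \<bar>s\<bar>))"
    using real_sqrt_mult_self[of "2 * pi"] by (simp add: scaleR_conv_of_real flip: of_real_mult mult.assoc) simp
  finally show ?thesis .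
qed

definition cauchy_distribution :: "real measure" where
  "cauchy_distribution = density lborel (\<lambda>t. 1 / (pi * (1 + t\<^sup>2)))"

lemma char_cauchy_distribution: "char cauchy_distribution s = of_real (exp (- \<bar>s\<bar>))"
proof -
  have pos: "1 + t\<^sup>2 > 0" for t :: real by (simp add: add_pos_nonneg)
  have "char cauchy_distribution s = (CLINT t|lborel. (1 / (pi * (1 + t\<^sup>2))) *\<^sub>R iexp (s * t))"
    unfolding char_def cauchy_distribution_def
    using pos by (subst integral_density) (auto simp: less_imp_le)
  also have "\<dots> = (1 / pi) *\<^sub>R (CLINT t|lborel. (1 / (1 + t\<^sup>2)) *\<^sub>R iexp (s * t))"
    by (simp flip: integral_scaleR_right)
  also have "\<dots> = of_real (exp (- \<bar>s\<bar>))"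
    by (simp only: fourier_transform_inverse_1_plus_square) (simp add: scaleR_conv_of_real)
  finally show ?thesis .
qed

lemma finite_measure_cauchy_distribution: "finite_measure cauchy_distribution"
proof -
  have "integrable lborel (\<lambda>t::real. (1 / pi) * (1 / (1 + t\<^sup>2)))"
    by (intro integrable_mult_right integrable_inverse_1_plus_square_UNIV)
  then have "(\<integral>\<^sup>+ t. ennreal (1 / (pi * (1 + t\<^sup>2))) \<partial>lborel) < \<infinity>"
    by (simp add: integrable_iff_bounded add_nonneg_nonneg)
  then show ?thesis
    by (intro finite_measureI) (simp add: cauchy_distribution_def emeasure_density)
qed

section \<open>Poisson measures\<close>

lemma prime_nth_prime: "prime (nth_prime k)"
  using enumerate_in_set[OF primes_infinite, of k] by (simp add: nth_prime_def)

lemma nth_prime_gt_1: "nth_prime k > 1"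
  using prime_nth_prime prime_gt_1_nat by blast

lemma nth_prime_eq_iff [simp]: "nth_prime j = nth_prime k \<longleftrightarrow> j = k"
  using inj_enumerate[OF primes_infinite] by (auto simp: nth_prime_def inj_eq)

text \<open>
  Unique factorization: \<open>tau m = 0\<close> makes the product of the prime powers with positive exponent equal
  to the product of those with negative exponent. A prime that occurs on one side would divide the
  other side, which is a product of powers of different primes.
\<close>

lemma tau_eq_0_imp_eq_0:
  assumes "tau n = 0"
  shows "n = 0"
proof -
  have nonpos: "Poly_Mapping.lookup m k \<le> 0" if "tau m = 0" for m k
  proof (rule ccontr)
    assume k: "\<not> Poly_Mapping.lookup m k \<le> 0"
    let ?K = "Poly_Mapping.keys m"
    \<comment> \<open>The truncation of nat separates the positive from the negative exponents.\<close>
    define A where "A = (\<Prod>i\<in>?K. nth_prime i ^ nat (Poly_Mapping.lookup m i))"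
    define B where "B = (\<Prod>i\<in>?K. nth_prime i ^ nat (- Poly_Mapping.lookup m i))"
    have p0: "real (nth_prime i) > 0" for i using nth_prime_gt_1[of i] by simp
    have "ln (real A) - ln (real B) = (\<Sum>i\<in>?K. real (nat (Poly_Mapping.lookup m i)) * ln (real (nth_prime i))
        - real (nat (- Poly_Mapping.lookup m i)) * ln (real (nth_prime i)))"
      using p0 by (simp add: A_def B_def ln_prod ln_realpow sum_subtractf)
    also have "\<dots> = (\<Sum>i\<in>?K. (real (nat (Poly_Mapping.lookup m i)) - real (nat (- Poly_Mapping.lookup m i)))
        * ln (real (nth_prime i)))"
      by (simp add: left_diff_distrib)
    also have "\<dots> = tau m"
      unfolding tau_def by (intro sum.cong refl arg_cong2[where f = "(*)"]) linarith
    finally have "ln (real A) = ln (real B)" using that by simp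
    moreover have "real A > 0" "real B > 0"
      using p0 by (auto simp: A_def B_def intro!: prod_pos)
    ultimately have "A = B" by simp
    have "nth_prime k dvd nth_prime k ^ nat (Poly_Mapping.lookup m k)"
      using k by (simp add: dvd_power)
    also have "\<dots> dvd A"
      unfolding A_def using k by (intro dvd_prodI) (auto simp: in_keys_iff)
    finally have "nth_prime k dvd B" using \<open>A = B\<close> by simp
    then obtain j where "nth_prime k dvd nth_prime j ^ nat (- Poly_Mapping.lookup m j)"
      unfolding B_def using prime_nth_prime by (auto simp: prime_dvd_prod_iff)
    moreover from this have "nth_prime k dvd nth_prime j"
      using prime_nth_prime prime_dvd_power by blast
    then have "j = k"
      using primes_dvd_imp_eq[OF prime_nth_prime prime_nth_prime, of k j] by simp
    ultimately show False
      using k nth_prime_gt_1[of k] by simp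
  qed
  have "Poly_Mapping.lookup n k = 0" for k
    using nonpos[OF assms, of k] nonpos[of "- n" k] assms by (simp add: tau_uminus)
  then show ?thesis by (intro poly_mapping_eqI) simp
qed

text \<open>
  On the half space \<open>tau \<ge> 0\<close> the absolute value in the coefficient is the identity. For \<open>s = \<infinity>\<close>, two
  exponent vectors in the half space with sum \<open>0\<close> both have \<open>tau = 0\<close> and so are both \<open>0\<close>.
\<close>

lemma poisson_coeff_add:
  assumes "tau n \<ge> 0" "tau m \<ge> 0"
  shows "poisson_coeff s (n + m) = poisson_coeff s n * poisson_coeff s m"
proof (cases "s = \<infinity>")
  case True
  have "n = 0 \<and> m = 0" if "n + m = 0"
  proof -
    have "tau n + tau m = 0" using that tau_add[of n m] by simp
    then have "tau n = 0" "tau m = 0" using assms by linarith+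
    then show ?thesis by (simp add: tau_eq_0_imp_eq_0)
  qed
  then show ?thesis using True by (auto simp: poisson_coeff_def)
next
  case False
  then show ?thesis
    using assms by (simp add: poisson_coeff_def tau_add distrib_left flip: exp_add)
qed

text \<open>
  For finite \<open>s\<close> the Cauchy distribution is transported by the one-parameter group
  \<open>t \<mapsto> (p\<^sub>k\<^sup>i\<^sup>s\<^sup>t)\<^sub>k\<close>. The scale \<open>s\<close> is put into the curve and not into the distribution, so that
  \<open>s = 0\<close> is covered: there the curve is constant and the measure a point mass.
\<close>

lemma is_poisson_exists: "\<exists>M. is_poisson s M"
proof (cases "s = \<infinity>")
  case True
  then show ?thesis using is_poisson_circle_product by blast
next
  case False
  define a where "a = enn2real s"
  let ?w = "\<lambda>t k. cis (a * t * ln (real (nth_prime k)))"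
  interpret C: finite_measure cauchy_distribution by (rule finite_measure_cauchy_distribution)
  have sets_C: "sets cauchy_distribution = sets borel"
    by (simp add: cauchy_distribution_def)
  have w: "?w \<in> measurable cauchy_distribution torus_borel"
  proof -
    have "?w \<in> borel_measurable borel"
      by (intro borel_measurable_continuous_onI continuous_on_coordinatewise_then_product continuous_intros)
    then show ?thesis
      unfolding torus_borel_def measurable_cong_sets[OF sets_C refl]
      by (intro measurable_restrict_space2) (auto simp: torus_def)
  qed
  let ?M = "distr cauchy_distribution torus_borel ?w"
  interpret M: torus_measure ?M
    using C.finite_measure_distr[OF w] by (intro torus_measure.intro) (auto simp: torus_measure_axioms_def)
  have char_w: "character n (?w t) = iexp (a * tau n * t)" for n t
  proof -
    have "character n (?w t) = (\<Prod>k\<in>Poly_Mapping.keys n. exp (\<i> * of_real (Poly_Mapping.lookup n k * ln (real (nth_prime k)) * (a * t))))"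
      unfolding character_def cis_power_int by (intro prod.cong) (auto simp: cis_conv_exp mult_ac)
    also have "\<dots> = iexp (tau n * (a * t))"
      by (simp add: tau_def sum_distrib_right sum_distrib_left flip: exp_sum)
    finally show ?thesis by (simp add: mult_ac)
  qed
  have "(LINT x|?M. character n x) = of_real (poisson_coeff s n)" for n
  proof -
    have "(LINT x|?M. character n x) = (LINT t|cauchy_distribution. character n (?w t))"
      using borel_measurable_continuous_on_restrict[OF continuous_on_character[of n]] w
      by (intro integral_distr) (auto simp: torus_borel_def)
    also have "\<dots> = char cauchy_distribution (a * tau n)"
      by (simp only: char_w char_def of_real_mult)
    also have "\<dots> = of_real (poisson_coeff s n)"
      using False by (simp add: char_cauchy_distribution poisson_coeff_def a_def abs_mult)
    finally show ?thesis .
  qed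
  then have "cnj (fourier_measure ?M n) = cnj (of_real (poisson_coeff s n))" for n
    by (simp add: M.integral_character)
  then have "is_poisson s ?M"
    unfolding is_poisson_def complex_cnj_cancel_iff using M.finite_measure_axioms by simp
  then show ?thesis by blast
qed

text \<open>
  The definite description in \<open>poisson\<close> ranges over all \<open>s\<close> with the given sequence of prime powers;
  the coordinate of the prime \<open>p = nth_prime 0\<close> alone recovers \<open>s\<close>, since \<open>p > 1\<close>.
\<close>

lemma prime_powers_inj: "prime_powers s = prime_powers s' \<Longrightarrow> s = s'"
proof -
  assume "prime_powers s = prime_powers s'"
  then have eq: "prime_powers s 0 = prime_powers s' 0" by simp
  have p: "real (nth_prime 0) > 1" using nth_prime_gt_1[of 0] by simp
  show "s = s'"
  proof (cases "s = \<infinity> \<or> s' = \<infinity>")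
    case True
    then show ?thesis using eq p by (auto simp: prime_powers_def split: if_splits)
  next
    case False
    then have "enn2real s = enn2real s'"
      using eq p by (simp add: prime_powers_def powr_inj)
    then show ?thesis
      using False by (metis ennreal_enn2real_if infinity_ennreal_def)
  qed
qed

lemma is_poisson_poisson: "is_poisson s (poisson (prime_powers s))"
proof -
  obtain M where M: "is_poisson s M" using is_poisson_exists by blast
  have "poisson (prime_powers s) = M"
    unfolding poisson_def using M
    by (intro the_equality) (auto dest: prime_powers_inj is_poisson_unique)
  then show ?thesis using M by simp
qed

section \<open>Approximation by convolution\<close>

lemma prob_space_haar: "prob_space haar"
  using is_haar_haar by (simp add: is_haar_def)

interpretation haar: torus_measure haar
  using is_haar_haar is_haar_iff_is_poisson torus_measure_if_is_poisson by blast

lemma integral_haar_mult: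
  fixes f :: "(nat \<Rightarrow> complex) \<Rightarrow> complex"
  assumes "l \<in> torus" "continuous_on torus f"
  shows "(LINT x|haar. f (torus_mult x l)) = (LINT x|haar. f x)"
  using haar.integral_translate[OF assms] is_haar_haar assms(1) by (simp add: is_haar_def)

lemma continuous_on_torus_mult:
  assumes "continuous_on S f" "continuous_on S g"
  shows "continuous_on S (\<lambda>p. torus_mult (f p) (g p))"
  unfolding torus_mult_def
  by (intro continuous_on_coordinatewise_then_product continuous_on_mult
      continuous_on_product_then_coordinatewise[OF assms(1)]
      continuous_on_product_then_coordinatewise[OF assms(2)])

lemma continuous_on_torus_compose_mult:
  assumes "continuous_on torus f" "x \<in> torus"
  shows "continuous_on torus (\<lambda>y. f (torus_mult x y))"
proof (rule continuous_on_compose2[OF assms(1)])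
  show "continuous_on torus (\<lambda>y. torus_mult x y)"
    by (rule continuous_on_torus_mult[OF continuous_on_const continuous_on_id])
  show "(\<lambda>y. torus_mult x y) ` torus \<subseteq> torus"
    using assms(2) by (auto intro: torus_mult_in_torus)
qed

definition bump :: "real \<Rightarrow> (nat \<Rightarrow> complex) \<Rightarrow> real" where
  "bump d y = max 0 (d - dist y (\<lambda>_. 1))"

lemma continuous_on_bump [continuous_intros]: "continuous_on S (bump d)"
  unfolding bump_def by (intro continuous_intros)

lemma bump_nonneg: "bump d y \<ge> 0"
  by (simp add: bump_def)

text \<open>
  Haar measure has full support: by compactness, finitely many translates of the bump have a sum
  that is positive on the whole torus, and by invariance all their integrals agree.
\<close>

lemma integral_bump_pos:
  assumes "d > 0"
  shows "(LINT y|haar. bump d y) > 0"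
proof (rule ccontr)
  interpret prob_space haar by (rule prob_space_haar)
  assume "\<not> 0 < (LINT y|haar. bump d y)"
  moreover have "(LINT y|haar. bump d y) \<ge> 0"
    by (intro integral_nonneg_AE AE_I2 bump_nonneg)
  ultimately have I0: "(LINT y|haar. bump d y) = 0" by simp
  have trans0: "(LINT y|haar. bump d (torus_mult y x)) = 0" if "x \<in> torus" for x
  proof -
    have "complex_of_real (LINT y|haar. bump d (torus_mult y x)) = (LINT y|haar. of_real (bump d (torus_mult y x)))"
      by simp
    also have "\<dots> = (LINT y|haar. of_real (bump d y))"
      by (intro integral_haar_mult[OF that, of "\<lambda>y. of_real (bump d y)"] continuous_intros)
    also have "\<dots> = 0" using I0 by simp
    finally show ?thesis by simp
  qed
  let ?U = "\<lambda>x. {y. dist (torus_mult y x) (\<lambda>_. 1) < d}"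
  have "open (?U x)" for x
    by (intro open_Collect_less continuous_on_dist continuous_on_const
        continuous_on_torus_mult[OF continuous_on_id continuous_on_const])
  moreover have "torus \<subseteq> (\<Union>x\<in>torus. ?U x)"
  proof
    fix y :: "nat \<Rightarrow> complex" assume y: "y \<in> torus"
    then have "torus_mult y (torus_inverse y) = (\<lambda>_. 1)"
      using torus_nonzero[OF y] by (simp add: torus_mult_def torus_inverse_def fun_eq_iff)
    then show "y \<in> (\<Union>x\<in>torus. ?U x)"
      using torus_inverse_in_torus[OF y] assms by (intro UN_I[of "torus_inverse y"]) auto
  qed
  ultimately obtain C where C: "C \<subseteq> torus" "finite C" "torus \<subseteq> (\<Union>x\<in>C. ?U x)"
    using compactE_image[OF compact_torus, of torus ?U] by metis
  let ?G = "\<lambda>y. \<Sum>x\<in>C. bump d (torus_mult y x)"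
  have cont: "continuous_on torus (\<lambda>y. bump d (torus_mult y x))" for x
    by (rule continuous_on_compose2[OF continuous_on_bump[of UNIV]
          continuous_on_torus_mult[OF continuous_on_id continuous_on_const]]) simp
  have "(LINT y|haar. ?G y) = (\<Sum>x\<in>C. LINT y|haar. bump d (torus_mult y x))"
    by (intro Bochner_Integration.integral_sum haar.integrable_continuous cont)
  also have "\<dots> = 0" using trans0 C(1) by (intro sum.neutral) auto
  finally have "(LINT y|haar. ?G y) = 0" .
  moreover have "integrable haar ?G"
    by (intro Bochner_Integration.integrable_sum haar.integrable_continuous cont)
  ultimately have "AE y in haar. ?G y = 0"
    using integral_nonneg_eq_0_iff_AE[of haar ?G] by (auto intro!: sum_nonneg bump_nonneg)
  moreover have "?G y > 0" if y: "y \<in> torus" for y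
  proof -
    obtain x where x: "x \<in> C" "dist (torus_mult y x) (\<lambda>_. 1) < d" using C(3) y by auto
    then have "bump d (torus_mult y x) > 0" by (simp add: bump_def)
    then show ?thesis
      using x(1) C(2) by (intro sum_pos2[of C x]) (auto intro: bump_nonneg)
  qed
  then have "AE y in haar. ?G y > 0"
    by (intro AE_I2) (simp add: haar.space_M)
  ultimately have "AE y in haar. False"
    by eventually_elim simp
  then show False by (simp add: AE_False)
qed

lemma uniformly_continuous_torus_mult:
  fixes f :: "(nat \<Rightarrow> complex) \<Rightarrow> complex"
  assumes "continuous_on torus f" "e > 0"
  obtains d where "d > 0"
    "\<And>x y. x \<in> torus \<Longrightarrow> y \<in> torus \<Longrightarrow> dist y (\<lambda>_. 1) < d \<Longrightarrow> norm (f (torus_mult x y) - f x) < e"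
proof -
  let ?F = "\<lambda>p. f (torus_mult (fst p) (snd p))"
  have "continuous_on (torus \<times> torus) ?F"
    by (rule continuous_on_compose2[OF assms(1) continuous_on_torus_mult[OF
            continuous_on_fst[OF continuous_on_id] continuous_on_snd[OF continuous_on_id]]])
      (auto intro: torus_mult_in_torus)
  then have "uniformly_continuous_on (torus \<times> torus) ?F"
    by (intro compact_uniformly_continuous compact_Times compact_torus)
  then obtain d where d: "d > 0"
    "\<And>p q. p \<in> torus \<times> torus \<Longrightarrow> q \<in> torus \<times> torus \<Longrightarrow> dist q p < d \<Longrightarrow> dist (?F q) (?F p) < e"
    using assms(2) unfolding uniformly_continuous_on_def by metis
  show thesis
  proof (rule that[OF d(1)])
    fix x y :: "nat \<Rightarrow> complex"
    assume "x \<in> torus" "y \<in> torus" "dist y (\<lambda>_. 1) < d"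
    then show "norm (f (torus_mult x y) - f x) < e"
      using d(2)[of "(x, \<lambda>_. 1)" "(x, y)"] one_in_torus by (simp add: dist_Pair_Pair dist_norm)
  qed
qed

text \<open>
  Substituting \<open>u = x y\<close> turns the convolution with a character into a Fourier coefficient. With
  the product \<open>x y\<close> in place of the usual \<open>x y\<^sup>-\<^sup>1\<close> the substitution is a translation, and the
  frequency \<open>n\<close> becomes \<open>- n\<close>.
\<close>

lemma integral_haar_mult_character:
  assumes f: "continuous_on torus f" and x: "x \<in> torus"
  shows "(LINT y|haar. f (torus_mult x y) * character n y) = fourier f (- n) * character (- n) x"
proof -
  let ?g = "\<lambda>u. f u * (character n u * cnj (character n x))"
  have "(LINT y|haar. f (torus_mult x y) * character n y) = (LINT y|haar. ?g (torus_mult y x))"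
  proof (intro Bochner_Integration.integral_cong refl)
    fix y
    have "character n x * cnj (character n x) = 1"
      using complex_norm_square[of "character n x"] norm_character[OF x] by simp
    then show "f (torus_mult x y) * character n y = ?g (torus_mult y x)"
      by (simp add: character_mult torus_mult_commute mult.assoc)
  qed
  also have "\<dots> = (LINT u|haar. ?g u)"
    by (intro integral_haar_mult x continuous_intros f)
  also have "\<dots> = (LINT u|haar. (f u * cnj (character (- n) u)) * character (- n) x)"
    using x by (intro Bochner_Integration.integral_cong refl)
      (simp add: haar.space_M character_uminus mult_ac)
  also have "\<dots> = fourier f (- n) * character (- n) x"
    by (simp add: fourier_def)
  finally show ?thesis .
qed

lemma trig_poly_convolution:
  assumes f: "f \<in> A_tau" and q: "trig_poly UNIV q"
  shows "trig_poly {n. tau n \<ge> 0} (\<lambda>x. LINT y|haar. f (torus_mult x y) * q y)"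
  using q
proof (induction rule: trig_poly.induct)
  case (zero q)
  have "(LINT y|haar. f (torus_mult x y) * q y) = (LINT y|haar. 0)" for x
    using zero by (intro Bochner_Integration.integral_cong) (auto simp: haar.space_M)
  then show ?case by (auto intro: trig_poly.zero)
next
  case (step n p q c)
  have fc: "continuous_on torus f" using f by (simp add: A_tau_def)
  have eq: "(LINT y|haar. f (torus_mult x y) * q y)
      = (c * fourier f (- n)) * character (- n) x + (LINT y|haar. f (torus_mult x y) * p y)"
    if x: "x \<in> torus" for x
  proof -
    note [continuous_intros] = continuous_on_torus_compose_mult[OF fc x] trig_poly_continuous[OF step(2)]
    have "(LINT y|haar. f (torus_mult x y) * q y)
      = (LINT y|haar. c * (f (torus_mult x y) * character n y) + f (torus_mult x y) * p y)"
      using step by (intro Bochner_Integration.integral_cong) (auto simp: haar.space_M algebra_simps)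
    also have "\<dots> = c * (LINT y|haar. f (torus_mult x y) * character n y) + (LINT y|haar. f (torus_mult x y) * p y)"
      by (subst Bochner_Integration.integral_add) (auto intro!: haar.integrable_continuous continuous_intros)
    finally show ?thesis by (simp add: integral_haar_mult_character[OF fc x])
  qed
  show ?case
  proof (cases "tau (- n) \<ge> 0")
    case True
    then show ?thesis
      using eq by (intro trig_poly.step[OF _ step.IH]) auto
  next
    case False
    then have "fourier f (- n) = 0" using f by (simp add: A_tau_def)
    then show ?thesis
      using eq by (intro trig_poly_cong[OF step.IH]) simp
  qed
qed

text \<open>
  The approximant is the convolution of \<open>f\<close> with a trigonometric polynomial \<open>q\<close> near a bump of
  integral \<open>H\<close>, divided by \<open>H\<close>. The error has two parts of size \<open>e / 2\<close>: one because \<open>f\<close> varies by less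
  than \<open>e / 2\<close> over the support of the bump, one because \<open>q\<close> is not the bump itself.
\<close>

lemma A_tau_approx:
  assumes f: "f \<in> A_tau" and e: "e > 0"
  shows "\<exists>q. trig_poly {n. tau n \<ge> 0} q \<and> (\<forall>x\<in>torus. norm (f x - q x) \<le> e)"
proof -
  interpret prob_space haar by (rule prob_space_haar)
  have m1: "measure haar torus = 1" using prob_space haar.space_M by simp
  have fc: "continuous_on torus f" using f by (simp add: A_tau_def)
  obtain B where B: "\<And>x. x \<in> torus \<Longrightarrow> norm (f x) \<le> B"
    using compact_imp_bounded[OF compact_continuous_image[OF fc compact_torus]]
    by (auto simp: bounded_iff)
  have "0 \<le> B" using B[OF one_in_torus] norm_ge_zero order_trans by blast
  obtain d where d: "d > 0"
    "\<And>x y. x \<in> torus \<Longrightarrow> y \<in> torus \<Longrightarrow> dist y (\<lambda>_. 1) < d \<Longrightarrow> norm (f (torus_mult x y) - f x) < e / 2"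
    using uniformly_continuous_torus_mult[OF fc, of "e / 2"] e by auto
  define H where "H = (LINT y|haar. bump d y)"
  have H: "H > 0" unfolding H_def by (rule integral_bump_pos[OF d(1)])
  \<comment> \<open>Chosen so that B * \<eta> / H stays below e / 2; the summand 1 avoids division by 0 when f vanishes.\<close>
  define \<eta> where "\<eta> = e * H / (2 * (B + 1))"
  have "\<eta> > 0" using e H \<open>0 \<le> B\<close> by (simp add: \<eta>_def)
  have B\<eta>: "B * \<eta> \<le> e / 2 * H"
  proof -
    have "B * \<eta> = (e / 2 * H) * (B / (B + 1))" by (simp add: \<eta>_def)
    also have "\<dots> \<le> e / 2 * H" using e H \<open>0 \<le> B\<close> by (intro mult_left_le) auto
    finally show ?thesis .
  qed
  obtain q where q: "trig_poly UNIV q" "\<And>y. y \<in> torus \<Longrightarrow> norm (of_real (bump d y) - q y) < \<eta>"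
    using trig_poly_dense[OF continuous_on_bump \<open>\<eta> > 0\<close>, of d] by blast
  let ?Q = "\<lambda>x. of_real (1 / H) * (LINT y|haar. f (torus_mult x y) * q y)"
  have "norm (f x - ?Q x) \<le> e" if x: "x \<in> torus" for x
  proof -
    note [continuous_intros] = continuous_on_torus_compose_mult[OF fc x] trig_poly_continuous[OF q(1)]
    have "of_real H * f x = (LINT y|haar. f x * of_real (bump d y))"
      by (simp add: H_def mult.commute)
    then have "of_real H * (f x - ?Q x) = (LINT y|haar. f x * of_real (bump d y)) - (LINT y|haar. f (torus_mult x y) * q y)"
      using H by (simp add: right_diff_distrib)
    also have "\<dots> = (LINT y|haar. f x * of_real (bump d y) - f (torus_mult x y) * q y)"
      by (intro Bochner_Integration.integral_diff[symmetric] haar.integrable_continuous continuous_intros)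
    also have "\<dots> = (LINT y|haar. (f x - f (torus_mult x y)) * of_real (bump d y)
        + f (torus_mult x y) * (of_real (bump d y) - q y))"
      by (simp add: algebra_simps)
    also have "\<dots> = (LINT y|haar. (f x - f (torus_mult x y)) * of_real (bump d y))
        + (LINT y|haar. f (torus_mult x y) * (of_real (bump d y) - q y))"
      by (intro Bochner_Integration.integral_add haar.integrable_continuous continuous_intros)
    also have "norm \<dots> \<le> e / 2 * H + B * \<eta>"
    proof (rule order_trans[OF norm_triangle_ineq add_mono])
      have "norm (LINT y|haar. (f x - f (torus_mult x y)) * of_real (bump d y))
          \<le> (LINT y|haar. norm ((f x - f (torus_mult x y)) * of_real (bump d y)))"
        by simp
      also have "\<dots> \<le> (LINT y|haar. e / 2 * bump d y)"
      proof (intro integral_mono haar.integrable_continuous continuous_intros)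
        fix y assume "y \<in> space haar"
        then have y: "y \<in> torus" by (simp add: haar.space_M)
        show "norm ((f x - f (torus_mult x y)) * of_real (bump d y)) \<le> e / 2 * bump d y"
        proof (cases "dist y (\<lambda>_. 1) < d")
          case True
          then have "norm (f x - f (torus_mult x y)) \<le> e / 2"
            using d(2)[OF x y] by (simp add: norm_minus_commute less_imp_le)
          from mult_right_mono[OF this bump_nonneg[of d y]] show ?thesis
            using bump_nonneg[of d y] by (simp add: norm_mult)
        next
          case False
          then have "bump d y = 0" by (simp add: bump_def)
          then show ?thesis by simp
        qed
      qed
      finally show "norm (LINT y|haar. (f x - f (torus_mult x y)) * of_real (bump d y)) \<le> e / 2 * H"
        by (simp add: H_def)
      have "norm (LINT y|haar. f (torus_mult x y) * (of_real (bump d y) - q y)) \<le> B * \<eta> * measure haar torus"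
        using B q(2) x \<open>0 \<le> B\<close>
        by (intro haar.norm_integral_le continuous_intros)
          (auto simp: norm_mult less_imp_le torus_mult_in_torus intro!: mult_mono)
      then show "norm (LINT y|haar. f (torus_mult x y) * (of_real (bump d y) - q y)) \<le> B * \<eta>"
        by (simp add: m1)
    qed
    also have "\<dots> \<le> H * e" using B\<eta> by (simp add: algebra_simps)
    finally have "H * norm (f x - ?Q x) \<le> H * e"
      using H by (simp add: norm_mult)
    then show ?thesis using H by simp
  qed
  moreover have "trig_poly {n. tau n \<ge> 0} ?Q"
    by (intro trig_poly_cmult trig_poly_convolution f q)
  ultimately show ?thesis by blast
qed

section \<open>Multiplicativity\<close>

lemma one_in_A_tau: "(\<lambda>_. 1) \<in> A_tau"
proof -
  have "fourier (\<lambda>_. 1) n = 0" if "tau n < 0" for n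
  proof -
    have "n \<noteq> 0" using that by auto
    from fourier_eq_0_if_is_haar[OF is_haar_haar this]
    show ?thesis by (simp add: fourier_def fourier_measure_def)
  qed
  then show ?thesis by (simp add: A_tau_def)
qed

text \<open>
  The identity passes from characters to \<open>A_tau\<close> in one factor at a time. With one factor \<open>a\<close> fixed,
  it says that \<open>a\<close> minus its mean annihilates the other factor, and this needs to be tested only on
  characters \<open>\<gamma>\<^sub>m\<close> with \<open>tau m \<ge> 0\<close>: first for \<open>a = \<gamma>\<^sub>n\<close>, then, by the first step, for \<open>a = f\<close>.
\<close>

lemma (in torus_measure) integral_mult_A_tau:
  assumes mult: "\<And>n m. tau n \<ge> 0 \<Longrightarrow> tau m \<ge> 0 \<Longrightarrow>
      (LINT x|M. character (n + m) x) = (LINT x|M. character n x) * (LINT x|M. character m x)"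
    and f: "f \<in> A_tau" and g: "g \<in> A_tau" and M1: "measure M torus = 1"
  shows "(LINT x|M. f x * g x) = (LINT x|M. f x) * (LINT x|M. g x)"
proof -
  note fc [continuous_intros] = f[unfolded A_tau_def, THEN CollectD, THEN conjunct1]
  note gc [continuous_intros] = g[unfolded A_tau_def, THEN CollectD, THEN conjunct1]
  have centred: "(LINT x|M. (a x - (LINT x|M. a x)) * b x) = (LINT x|M. a x * b x) - (LINT x|M. a x) * (LINT x|M. b x)"
    if [continuous_intros]: "continuous_on torus a" "continuous_on torus b"
    for a b :: "(nat \<Rightarrow> complex) \<Rightarrow> complex"
  proof -
    have "(LINT x|M. (a x - (LINT x|M. a x)) * b x) = (LINT x|M. a x * b x - (LINT x|M. a x) * b x)"
      by (simp add: algebra_simps)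
    also have "\<dots> = (LINT x|M. a x * b x) - (LINT x|M. (LINT x|M. a x) * b x)"
      by (intro Bochner_Integration.integral_diff integrable_continuous continuous_intros)
    finally show ?thesis by simp
  qed
  have char: "(LINT x|M. character n x * f x) = (LINT x|M. character n x) * (LINT x|M. f x)"
    if n: "tau n \<ge> 0" for n
  proof -
    let ?w = "\<lambda>x. character n x - (LINT x|M. character n x)"
    have "(LINT x|M. ?w x * f x) = 0"
    proof (rule integral_mult_eq_0_if_approximable[OF _ fc _ A_tau_approx[OF f]])
      show "continuous_on torus ?w" by (intro continuous_intros)
      fix m assume m: "m \<in> {n. tau n \<ge> 0}"
      have "(LINT x|M. character n x * character m x) = (LINT x|M. character (n + m) x)"
        by (intro Bochner_Integration.integral_cong) (auto simp: space_M character_add)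
      then show "(LINT x|M. ?w x * character m x) = 0"
        using mult[OF n, of m] m by (simp add: centred continuous_on_character)
    qed
    then show ?thesis by (simp add: centred continuous_on_character fc)
  qed
  let ?w = "\<lambda>x. f x - (LINT x|M. f x)"
  have "(LINT x|M. ?w x * g x) = 0"
  proof (rule integral_mult_eq_0_if_approximable[OF _ gc _ A_tau_approx[OF g]])
    show "continuous_on torus ?w" by (intro continuous_intros)
    fix n assume n: "n \<in> {n. tau n \<ge> 0}"
    then show "(LINT x|M. ?w x * character n x) = 0"
      using char[of n] by (simp add: centred continuous_on_character fc) (simp add: mult.commute)
  qed
  then show ?thesis by (simp add: centred fc gc)
qed

theorem theorem5p7:
  fixes r :: "nat \<Rightarrow> real" and \<sigma> :: ennreal and l :: "nat \<Rightarrow> complex"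
  assumes "r = prime_powers \<sigma>"
    and "l \<in> torus"
  shows "complex_homomorphism torus A_tau (\<lambda>f. LINT x|poisson_at r l. f x)"
proof -
  define P where "P = poisson (prime_powers \<sigma>)"
  define M where "M = poisson_at r l"
  have P: "is_poisson \<sigma> P" unfolding P_def by (rule is_poisson_poisson)
  interpret P: torus_measure P using P by (rule torus_measure_if_is_poisson)
  have M_eq: "M = translate l P" by (simp add: M_def poisson_at_def assms(1) P_def)
  interpret M: torus_measure M
    unfolding M_eq by (rule P.torus_measure_translate[OF assms(2)])
  have coeff: "(LINT x|M. character n x) = character n l * of_real (poisson_coeff \<sigma> n)" for n
    using P assms(2)
    by (simp add: M.integral_character) (simp add: M_eq P.fourier_translate is_poisson_def)
  have mult: "(LINT x|M. character (n + m) x) = (LINT x|M. character n x) * (LINT x|M. character m x)"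
    if "tau n \<ge> 0" "tau m \<ge> 0" for n m
    using that assms(2) by (simp add: coeff character_add poisson_coeff_add)
  have "(LINT x|M. (1::complex)) = 1"
    using coeff[of 0] by (simp add: poisson_coeff_def)
  then have one: "measure M torus = 1"
    by (simp add: M.space_M scaleR_conv_of_real)
  have cont: "continuous_on torus f" if "f \<in> A_tau" for f
    using that by (simp add: A_tau_def)
  show ?thesis
    unfolding complex_homomorphism_def M_def[symmetric]
  proof (intro conjI ballI allI impI)
    fix f g :: "(nat \<Rightarrow> complex) \<Rightarrow> complex" assume f: "f \<in> A_tau" and g: "g \<in> A_tau"
    show "(LINT x|M. f x + g x) = (LINT x|M. f x) + (LINT x|M. g x)"
      by (intro Bochner_Integration.integral_add M.integrable_continuous cont f g)
    show "(LINT x|M. f x * g x) = (LINT x|M. f x) * (LINT x|M. g x)"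
      by (rule M.integral_mult_A_tau[OF mult f g one])
    assume "\<forall>x\<in>torus. f x = g x"
    then show "(LINT x|M. f x) = (LINT x|M. g x)"
      by (intro Bochner_Integration.integral_cong) (auto simp: M.space_M)
  next
    show "\<exists>f\<in>A_tau. (LINT x|M. f x) \<noteq> 0"
      using one_in_A_tau \<open>(LINT x|M. (1::complex)) = 1\<close> by (intro bexI[of _ "\<lambda>_. 1"]) auto
  qed simp
qed

end
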